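(* Let $(M,g)$ be a Riemannian manifold of dimension $n>2$ with Levi-Civita connection $\nabla$ and Ricci tensor $\mathrm{r}$, and let $\tau,\alpha,\sigma:M\to\mathbb{R}$ be functions such that $\alpha$ is a $C^\infty$ function of $\tau$, the tensor $\alpha\nabla d\tau$ is nonzero on a dense subset of $M$, and $$\alpha\nabla d\tau+\mathrm{r}=\sigma g .$$ Set $v=\nabla\tau$, $Q=g(\nabla\tau,\nabla\tau)$ and $Y=\Delta\tau$, and suppose in addition that $$2\,\mathrm{r}(v,\,\cdot\,)=-\,dY .$$ Then, at points where $\alpha''+\alpha\alpha'\neq0$ and $d\tau\neq0$, both $Q$ and $Y$ are, locally, functions of $\tau$. Here $\alpha'=d\alpha/d\tau$ and $\alpha''=d^2\alpha/d\tau^2$.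
   Context: All manifolds and metrics are of class $C^\infty$, and manifolds are connected. $\nabla\tau$ denotes the $g$-gradient of $\tau$, $\nabla d\tau$ its Hessian (a symmetric 2-tensor), and $\Delta\tau$ its Laplacian (the $g$-trace of $\nabla d\tau$). "$\alpha$ is a $C^\infty$ function of $\tau$" means that $\alpha$ is the composite of $\tau$ with a $C^\infty$ function of a real variable, and $\alpha',\alpha''$ (derivatives with respect to that real variable) are also treated as functions on $M$ by composing with $\tau$. *)

theory Defs
  imports "HOL-Analysis.Analysis"
begin

section \<open>Smooth maps on open subsets of Euclidean spaces\<close>

text \<open>
  These two predicates are meaningful for open \<open>S\<close> only, since \<open>at x\<close> is the
  full neighbourhood filter. The derivative enters through all directional
  derivatives, so that the recursion stays within one type.
\<close>

primrec Ck_on :: "nat \<Rightarrow> 'a::euclidean_space set \<Rightarrow> ('a \<Rightarrow> 'b::real_normed_vector) \<Rightarrow> bool" where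
  "Ck_on 0 S f \<longleftrightarrow> continuous_on S f"
| "Ck_on (Suc k) S f \<longleftrightarrow>
     (\<forall>x\<in>S. f differentiable (at x)) \<and>
     (\<forall>v. Ck_on k S (\<lambda>x. frechet_derivative f (at x) v))"

definition smooth_on :: "'a::euclidean_space set \<Rightarrow> ('a \<Rightarrow> 'b::real_normed_vector) \<Rightarrow> bool" where
  "smooth_on S f \<longleftrightarrow> (\<forall>k. Ck_on k S f)"


section \<open>Smooth manifolds\<close>

text \<open>
  A chart is a pair of an open subset of the manifold and a map from the points to
  \<open>real ^ 'n\<close>, whose values outside that subset are irrelevant; the dimension of the
  manifold is \<open>CARD('n)\<close>. A smooth structure is given by an atlas, which is not
  required to be maximal.
\<close>

type_synonym ('a, 'n) chart = "'a set \<times> ('a \<Rightarrow> real ^ 'n)"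

abbreviation dom_of :: "('a, 'n::finite) chart \<Rightarrow> 'a set" where
  "dom_of c \<equiv> fst c"

abbreviation map_of_chart :: "('a, 'n::finite) chart \<Rightarrow> 'a \<Rightarrow> real ^ 'n" where
  "map_of_chart c \<equiv> snd c"

definition is_chart :: "'a topology \<Rightarrow> ('a, 'n::finite) chart \<Rightarrow> bool" where
  "is_chart X c \<longleftrightarrow>
     openin X (dom_of c) \<and> open (map_of_chart c ` dom_of c) \<and>
     homeomorphic_map (subtopology X (dom_of c))
       (top_of_set (map_of_chart c ` dom_of c)) (map_of_chart c)"

text \<open>Smoothness, in the chart \<open>c\<close>, of a map defined on an open subset \<open>W\<close> of the domain of \<open>c\<close>.\<close>

definition smooth_in_chart ::
    "('a, 'n::finite) chart \<Rightarrow> 'a set \<Rightarrow> ('a \<Rightarrow> 'b::real_normed_vector) \<Rightarrow> bool" where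
  "smooth_in_chart c W f \<longleftrightarrow>
     smooth_on (map_of_chart c ` W) (f \<circ> inv_into (dom_of c) (map_of_chart c))"

definition smooth_manifold :: "'a topology \<Rightarrow> ('a, 'n::finite) chart set \<Rightarrow> bool" where
  "smooth_manifold X A \<longleftrightarrow>
     Hausdorff_space X \<and> second_countable X \<and> connected_space X \<and>
     (\<forall>c\<in>A. is_chart X c) \<and> (\<Union>c\<in>A. dom_of c) = topspace X \<and>
     (\<forall>c\<in>A. \<forall>c'\<in>A. smooth_in_chart c (dom_of c \<inter> dom_of c') (map_of_chart c'))"

definition smooth_function :: "('a, 'n::finite) chart set \<Rightarrow> ('a \<Rightarrow> real) \<Rightarrow> bool" where
  "smooth_function A f \<longleftrightarrow> (\<forall>c\<in>A. smooth_in_chart c (dom_of c) f)"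

text \<open>The value at \<open>p\<close> of the coordinate vector field \<open>\<partial>\<^sub>i\<close> of the chart \<open>c\<close> applied to \<open>f\<close>.\<close>

definition partial :: "('a, 'n::finite) chart \<Rightarrow> 'n \<Rightarrow> ('a \<Rightarrow> real) \<Rightarrow> 'a \<Rightarrow> real" where
  "partial c i f p =
     frechet_derivative (f \<circ> inv_into (dom_of c) (map_of_chart c)) (at (map_of_chart c p)) (axis i 1)"

text \<open>Row \<open>a\<close>, column \<open>i\<close> is the derivative of the \<open>a\<close>-th coordinate of \<open>c'\<close> along \<open>\<partial>\<^sub>i\<close> of \<open>c\<close>.\<close>

definition jacobian :: "('a, 'n::finite) chart \<Rightarrow> ('a, 'n) chart \<Rightarrow> 'a \<Rightarrow> real ^ 'n ^ 'n" where
  "jacobian c c' p = (\<chi> a i. partial c i (\<lambda>q. map_of_chart c' q $ a) p)"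


section \<open>Riemannian metrics and the Levi-Civita connection\<close>

text \<open>
  Vector fields, 1-forms and 2-tensors are given by their components in the charts of
  the atlas; components in a chart are meaningful on the domain of that chart only.
\<close>

type_synonym ('a, 'n) vec_field = "('a, 'n) chart \<Rightarrow> 'a \<Rightarrow> real ^ 'n"
type_synonym ('a, 'n) tensor2 = "('a, 'n) chart \<Rightarrow> 'a \<Rightarrow> real ^ 'n ^ 'n"
type_synonym ('a, 'n) conn = "('a, 'n) chart \<Rightarrow> 'a \<Rightarrow> real ^ 'n ^ 'n ^ 'n"

definition riemannian_metric :: "('a, 'n::finite) chart set \<Rightarrow> ('a, 'n) tensor2 \<Rightarrow> bool" where
  "riemannian_metric A g \<longleftrightarrow>
     (\<forall>c\<in>A. \<forall>i j. smooth_in_chart c (dom_of c) (\<lambda>p. g c p $ i $ j)) \<and>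
     (\<forall>c\<in>A. \<forall>p\<in>dom_of c.
        transpose (g c p) = g c p \<and> (\<forall>x. x \<noteq> 0 \<longrightarrow> x \<bullet> (g c p *v x) > 0)) \<and>
     (\<forall>c\<in>A. \<forall>c'\<in>A. \<forall>p \<in> dom_of c \<inter> dom_of c'.
        g c p = transpose (jacobian c c' p) ** g c' p ** jacobian c c' p)"

text \<open>
  A connection is given by its components \<open>\<Gamma> c p $ k $ i $ j\<close>, the coefficient of
  \<open>\<partial>\<^sub>k\<close> in \<open>\<nabla>\<^bsub>\<partial>\<^sub>i\<^esub> \<partial>\<^sub>j\<close>. The last clause is the classical change of coordinates: if \<open>x\<close> and \<open>y\<close>
  are the coordinates of \<open>c\<close> and \<open>c'\<close>, it reads
  \<open>\<partial>y\<^sup>l/\<partial>x\<^sup>k \<Gamma>\<^sup>k\<^sub>i\<^sub>j = \<partial>\<^sup>2y\<^sup>l/\<partial>x\<^sup>i\<partial>x\<^sup>j + \<partial>y\<^sup>a/\<partial>x\<^sup>i \<partial>y\<^sup>b/\<partial>x\<^sup>j \<Gamma>'\<^sup>l\<^sub>a\<^sub>b\<close> with summation over repeated indices.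
\<close>

definition affine_connection :: "('a, 'n::finite) chart set \<Rightarrow> ('a, 'n) conn \<Rightarrow> bool" where
  "affine_connection A \<Gamma> \<longleftrightarrow>
     (\<forall>c\<in>A. \<forall>k i j. smooth_in_chart c (dom_of c) (\<lambda>p. \<Gamma> c p $ k $ i $ j)) \<and>
     (\<forall>c\<in>A. \<forall>c'\<in>A. \<forall>p \<in> dom_of c \<inter> dom_of c'. \<forall>l i j.
        (\<Sum>k\<in>UNIV. jacobian c c' p $ l $ k * \<Gamma> c p $ k $ i $ j) =
        partial c i (\<lambda>q. jacobian c c' q $ l $ j) p +
        (\<Sum>a\<in>UNIV. \<Sum>b\<in>UNIV.
           jacobian c c' p $ a $ i * jacobian c c' p $ b $ j * \<Gamma> c' p $ l $ a $ b))"

definition torsion_free :: "('a, 'n::finite) chart set \<Rightarrow> ('a, 'n) conn \<Rightarrow> bool" where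
  "torsion_free A \<Gamma> \<longleftrightarrow>
     (\<forall>c\<in>A. \<forall>p\<in>dom_of c. \<forall>k i j. \<Gamma> c p $ k $ i $ j = \<Gamma> c p $ k $ j $ i)"

definition metric_compatible ::
    "('a, 'n::finite) chart set \<Rightarrow> ('a, 'n) tensor2 \<Rightarrow> ('a, 'n) conn \<Rightarrow> bool" where
  "metric_compatible A g \<Gamma> \<longleftrightarrow>
     (\<forall>c\<in>A. \<forall>p\<in>dom_of c. \<forall>k i j.
        partial c k (\<lambda>q. g c q $ i $ j) p =
        (\<Sum>l\<in>UNIV. \<Gamma> c p $ l $ k $ i * g c p $ l $ j) +
        (\<Sum>l\<in>UNIV. \<Gamma> c p $ l $ k $ j * g c p $ i $ l))"

definition levi_civita_connection ::
    "('a, 'n::finite) chart set \<Rightarrow> ('a, 'n) tensor2 \<Rightarrow> ('a, 'n) conn \<Rightarrow> bool" where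
  "levi_civita_connection A g \<Gamma> \<longleftrightarrow>
     affine_connection A \<Gamma> \<and> torsion_free A \<Gamma> \<and> metric_compatible A g \<Gamma>"


section \<open>Curvature\<close>

text \<open>
  \<open>curvature \<Gamma> c p l i j k\<close> is the coefficient of \<open>\<partial>\<^sub>l\<close> in \<open>R(\<partial>\<^sub>i, \<partial>\<^sub>j) \<partial>\<^sub>k\<close>, where
  \<open>R(u, v) w = \<nabla>\<^sub>u \<nabla>\<^sub>v w - \<nabla>\<^sub>v \<nabla>\<^sub>u w - \<nabla>\<^bsub>[u, v]\<^esub> w\<close>. The Ricci tensor \<open>r(v, w)\<close> is the trace
  of \<open>u \<mapsto> R(u, v) w\<close>, which makes it positive on round spheres.
\<close>

definition curvature ::
    "('a, 'n::finite) conn \<Rightarrow> ('a, 'n) chart \<Rightarrow> 'a \<Rightarrow> 'n \<Rightarrow> 'n \<Rightarrow> 'n \<Rightarrow> 'n \<Rightarrow> real" where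
  "curvature \<Gamma> c p l i j k =
     partial c i (\<lambda>q. \<Gamma> c q $ l $ j $ k) p - partial c j (\<lambda>q. \<Gamma> c q $ l $ i $ k) p +
     (\<Sum>m\<in>UNIV. \<Gamma> c p $ l $ i $ m * \<Gamma> c p $ m $ j $ k - \<Gamma> c p $ l $ j $ m * \<Gamma> c p $ m $ i $ k)"

definition ricci :: "('a, 'n::finite) conn \<Rightarrow> ('a, 'n) tensor2" where
  "ricci \<Gamma> c p = (\<chi> j k. \<Sum>i\<in>UNIV. curvature \<Gamma> c p i i j k)"


section \<open>Gradient, Hessian and Laplacian\<close>

definition differential :: "('a \<Rightarrow> real) \<Rightarrow> ('a, 'n::finite) chart \<Rightarrow> 'a \<Rightarrow> real ^ 'n" where
  "differential f c p = (\<chi> i. partial c i f p)"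

definition gradient :: "('a, 'n::finite) tensor2 \<Rightarrow> ('a \<Rightarrow> real) \<Rightarrow> ('a, 'n) vec_field" where
  "gradient g f c p = matrix_inv (g c p) *v differential f c p"

text \<open>The components of the covariant derivative of \<open>df\<close>.\<close>

definition hessian :: "('a, 'n::finite) conn \<Rightarrow> ('a \<Rightarrow> real) \<Rightarrow> ('a, 'n) tensor2" where
  "hessian \<Gamma> f c p =
     (\<chi> i j. partial c i (\<lambda>q. differential f c q $ j) p -
             (\<Sum>k\<in>UNIV. \<Gamma> c p $ k $ i $ j * differential f c p $ k))"

text \<open>
  Scalars obtained by contraction do not depend on the chart in which they are
  computed; they are evaluated in some chart around the point.
\<close>

definition chart_at :: "('a, 'n::finite) chart set \<Rightarrow> 'a \<Rightarrow> ('a, 'n) chart" where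
  "chart_at A p = (SOME c. c \<in> A \<and> p \<in> dom_of c)"

definition metric_inner ::
    "('a, 'n::finite) chart set \<Rightarrow> ('a, 'n) tensor2 \<Rightarrow> ('a, 'n) vec_field \<Rightarrow> ('a, 'n) vec_field \<Rightarrow> 'a \<Rightarrow> real"
  where "metric_inner A g v w p = (let c = chart_at A p in v c p \<bullet> (g c p *v w c p))"

definition metric_trace ::
    "('a, 'n::finite) chart set \<Rightarrow> ('a, 'n) tensor2 \<Rightarrow> ('a, 'n) tensor2 \<Rightarrow> 'a \<Rightarrow> real" where
  "metric_trace A g b p = (let c = chart_at A p in trace (matrix_inv (g c p) ** b c p))"

definition laplacian ::
    "('a, 'n::finite) chart set \<Rightarrow> ('a, 'n) tensor2 \<Rightarrow> ('a, 'n) conn \<Rightarrow> ('a \<Rightarrow> real) \<Rightarrow> 'a \<Rightarrow> real" where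
  "laplacian A g \<Gamma> f = metric_trace A g (hessian \<Gamma> f)"


section \<open>Functions of a function\<close>

text \<open>
  Near \<open>p\<close>, the function \<open>f\<close> is the composite of \<open>t\<close> with a smooth function of a real variable.
\<close>

definition locally_function_of ::
    "'a topology \<Rightarrow> 'a \<Rightarrow> ('a \<Rightarrow> real) \<Rightarrow> ('a \<Rightarrow> real) \<Rightarrow> bool" where
  "locally_function_of X p f t \<longleftrightarrow>
     (\<exists>U I F. openin X U \<and> p \<in> U \<and> open I \<and> is_interval I \<and> t ` U \<subseteq> I \<and>
        smooth_on I (F :: real \<Rightarrow> real) \<and> (\<forall>q\<in>U. f q = F (t q)))"

end

theory Submission
  imports Defs
begin

text \<open>
  Applied to \<open>v\<close>, the equation \<open>\<alpha>\<nabla>d\<tau> + r = \<sigma>g\<close> reads \<open>\<alpha> dQ - dY = 2\<sigma> d\<tau>\<close>, because \<open>dQ = 2\<nabla>d\<tau>(v, \<cdot>)\<close> and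
  \<open>dY = - 2r(v, \<cdot>)\<close>. Its divergence, combined with its trace, the contracted Bianchi identity and
  the Bochner formula \<open>div \<nabla>d\<tau> = dY + r(v, \<cdot>) = dY/2\<close>, reads \<open>\<alpha>' dQ + (n - 2) d\<sigma> = \<alpha>' Y d\<tau>\<close>.
  The first relation gives \<open>d\<tau> \<and> dY = \<alpha> d\<tau> \<and> dQ\<close>, and the exterior derivative of the second one gives
  \<open>\<alpha>'' d\<tau> \<and> dQ + \<alpha>' d\<tau> \<and> dY = 0\<close>. Hence \<open>(\<alpha>'' + \<alpha>\<alpha>') d\<tau> \<and> dQ = 0\<close>, so that \<open>dQ\<close> and \<open>dY\<close> are multiples
  of \<open>d\<tau>\<close> where the coefficient is not zero.
\<close>

section \<open>Calculus of smooth functions\<close>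

text \<open>Divergences enter through \<open>contracted_d\<close>, which for a torsion-free
  connection is the divergence minus the differential of the trace and has no Christoffel term on
  the free lower index. It sends \<sigma> times the identity to (1 - n) d\<sigma>, the Ricci tensor
  to - ds/2 with s its trace, and \<nabla>v to r(v, .) = - dY/2. The trace of the equation gives ds
  = n d\<sigma> - \<alpha>' Y d\<tau> - \<alpha> dY; the terms \<alpha> dY cancel, and the
  coefficient n - 2 is 2(n - 1) - n. The same trace shows that \<sigma> is smooth, which the
  exterior derivative of the relation containing d\<sigma> presupposes. Proportionality of dQ to
  d\<tau> only says that Q is constant along paths inside level sets of \<tau>. To obtain one
  function of \<tau>, the level sets are straightened so that, locally, they become convex and each
  meets one transversal curve; Q along that curve, parametrized by \<tau>, is the required function.
  Since \<open>metric_inner\<close> and \<open>metric_trace\<close> choose a chart at each point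
  separately, all of this needs Q and Y rewritten in one fixed chart beforehand.\<close>

abbreviation dirderiv :: "('a::euclidean_space \<Rightarrow> 'b::real_normed_vector) \<Rightarrow> 'a \<Rightarrow> 'a \<Rightarrow> 'b" where
  "dirderiv f v \<equiv> \<lambda>x. frechet_derivative f (at x) v"

lemma dirderiv_cong:
  assumes "open S" "x \<in> S" "\<And>y. y \<in> S \<Longrightarrow> f y = g y"
  shows "dirderiv f v x = dirderiv g v x"
proof -
  have "(f has_derivative F) (at x) \<longleftrightarrow> (g has_derivative F) (at x)" for F
    using has_derivative_transform_within_open[of f F x UNIV S g]
      has_derivative_transform_within_open[of g F x UNIV S f] assms by auto
  then show ?thesis by (simp add: frechet_derivative_def)
qed

lemma differentiable_cong_open:
  assumes "open S" "x \<in> S" "\<And>y. y \<in> S \<Longrightarrow> f y = g y" "f differentiable (at x)"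
  shows "g differentiable (at x)"
  using assms has_derivative_transform_within_open unfolding differentiable_def by blast

lemma Ck_on_cong:
  assumes "open S" "\<And>x. x \<in> S \<Longrightarrow> f x = g x" "Ck_on k S f"
  shows "Ck_on k S g"
  using assms(2,3)
proof (induction k arbitrary: f g)
  case 0
  then show ?case by (simp cong: continuous_on_cong)
next
  case (Suc k)
  have "Ck_on k S (dirderiv g v)" for v
    by (rule Suc.IH[of "dirderiv f v"]) (use Suc.prems in \<open>auto intro!: dirderiv_cong[OF assms(1)]\<close>)
  then show ?case
    using Suc.prems differentiable_cong_open[OF assms(1), of _ f g] by auto
qed

lemma smooth_on_cong:
  "open S \<Longrightarrow> (\<And>x. x \<in> S \<Longrightarrow> f x = g x) \<Longrightarrow> smooth_on S f \<Longrightarrow> smooth_on S g"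
  unfolding smooth_on_def using Ck_on_cong by blast

lemma Ck_on_subset: "Ck_on k S f \<Longrightarrow> T \<subseteq> S \<Longrightarrow> Ck_on k T f"
  by (induction k arbitrary: f) (auto intro: continuous_on_subset)

lemma smooth_on_subset: "smooth_on S f \<Longrightarrow> T \<subseteq> S \<Longrightarrow> smooth_on T f"
  unfolding smooth_on_def using Ck_on_subset by blast

lemma Ck_on_SucD: "Ck_on (Suc k) S f \<Longrightarrow> Ck_on k S f"
proof (induction k arbitrary: f)
  case 0
  then show ?case
    by (auto intro!: continuous_at_imp_continuous_on differentiable_imp_continuous_within)
next
  case (Suc k)
  then show ?case by (metis Ck_on.simps(2))
qed

lemma smooth_on_Suc:
  "smooth_on S f \<longleftrightarrow> (\<forall>x\<in>S. f differentiable (at x)) \<and> (\<forall>v. smooth_on S (dirderiv f v))"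
  unfolding smooth_on_def by (metis Ck_on.simps(2) Ck_on_SucD)

lemma smooth_on_dirderiv: "smooth_on S f \<Longrightarrow> smooth_on S (dirderiv f v)"
  using smooth_on_Suc by blast

lemma smooth_on_differentiable: "smooth_on S f \<Longrightarrow> x \<in> S \<Longrightarrow> f differentiable (at x)"
  using smooth_on_Suc by blast

lemma smooth_on_continuous_on: "smooth_on S f \<Longrightarrow> continuous_on S f"
  unfolding smooth_on_def by (metis Ck_on.simps(1))

lemma has_derivative_dirderiv:
  "f differentiable (at x) \<Longrightarrow> (f has_derivative (\<lambda>v. dirderiv f v x)) (at x)"
  using frechet_derivative_works by (auto simp: eta_contract_eq)

lemma dirderiv_eqI: "(f has_derivative F) (at x) \<Longrightarrow> dirderiv f v x = F v"
  by (metis frechet_derivative_at)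

lemma Ck_on_const: "Ck_on k S (\<lambda>x. c)"
  by (induction k arbitrary: c) (simp_all)

lemma Ck_on_bounded_linear_compose:
  assumes L: "bounded_linear L" and S: "open S" and f: "Ck_on k S f"
  shows "Ck_on k S (\<lambda>x. L (f x))"
  using f
proof (induction k arbitrary: f)
  case 0
  then show ?case using L by (auto intro: bounded_linear.continuous_on)
next
  case (Suc k)
  have der: "((\<lambda>x. L (f x)) has_derivative (\<lambda>v. L (dirderiv f v x))) (at x)" if "x \<in> S" for x
    using bounded_linear.has_derivative[OF L has_derivative_dirderiv] Suc.prems that by auto
  have "Ck_on k S (dirderiv (\<lambda>x. L (f x)) v)" for v
    by (rule Ck_on_cong[OF S _ Suc.IH[of "dirderiv f v"]])
      (use Suc.prems dirderiv_eqI[OF der] in auto)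
  then show ?case using der by (auto simp: differentiable_def)
qed

lemma Ck_on_add:
  assumes S: "open S" and "Ck_on k S f" "Ck_on k S g"
  shows "Ck_on k S (\<lambda>x. f x + g x)"
  using assms(2,3)
proof (induction k arbitrary: f g)
  case 0
  then show ?case by (auto intro: continuous_on_add)
next
  case (Suc k)
  have der: "((\<lambda>x. f x + g x) has_derivative (\<lambda>v. dirderiv f v x + dirderiv g v x)) (at x)"
    if "x \<in> S" for x
    using Suc.prems that by (auto intro!: has_derivative_add has_derivative_dirderiv)
  have "Ck_on k S (dirderiv (\<lambda>x. f x + g x) v)" for v
    by (rule Ck_on_cong[OF S _ Suc.IH[of "dirderiv f v" "dirderiv g v"]])
      (use Suc.prems dirderiv_eqI[OF der] in auto)
  then show ?case using der by (auto simp: differentiable_def)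
qed

lemma Ck_on_mult:
  fixes f g :: "'a::euclidean_space \<Rightarrow> real"
  assumes S: "open S" and "Ck_on k S f" "Ck_on k S g"
  shows "Ck_on k S (\<lambda>x. f x * g x)"
  using assms(2,3)
proof (induction k arbitrary: f g)
  case 0
  then show ?case by (auto intro: continuous_on_mult)
next
  case (Suc k)
  have der: "((\<lambda>x. f x * g x) has_derivative (\<lambda>v. f x * dirderiv g v x + dirderiv f v x * g x)) (at x)"
    if "x \<in> S" for x
    using Suc.prems that by (auto intro!: has_derivative_mult has_derivative_dirderiv)
  have "Ck_on k S (dirderiv (\<lambda>x. f x * g x) v)" for v
    by (rule Ck_on_cong[OF S _ Ck_on_add[OF S Suc.IH[of f "dirderiv g v"] Suc.IH[of "dirderiv f v" g]]])
      (use Suc.prems Ck_on_SucD dirderiv_eqI[OF der] in auto)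
  then show ?case using der by (auto simp: differentiable_def)
qed

lemma Ck_on_inverse:
  fixes f :: "'a::euclidean_space \<Rightarrow> real"
  assumes S: "open S" and "Ck_on k S f" and nz: "\<And>x. x \<in> S \<Longrightarrow> f x \<noteq> 0"
  shows "Ck_on k S (\<lambda>x. inverse (f x))"
  using assms(2)
proof (induction k)
  case 0
  then show ?case using nz by (auto intro: continuous_on_inverse)
next
  case (Suc k)
  have der: "((\<lambda>x. inverse (f x)) has_derivative
      (\<lambda>v. - (inverse (f x) * dirderiv f v x * inverse (f x)))) (at x)" if "x \<in> S" for x
    using Suc.prems that nz by (intro Deriv.has_derivative_inverse has_derivative_dirderiv) auto
  have IH: "Ck_on k S (\<lambda>x. inverse (f x))" using Suc Ck_on_SucD by blast
  have "Ck_on k S (\<lambda>x. (- 1) * (inverse (f x) * dirderiv f v x * inverse (f x)))" for v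
    by (intro Ck_on_mult[OF S] Ck_on_const IH) (use Suc.prems in auto)
  then have "Ck_on k S (dirderiv (\<lambda>x. inverse (f x)) v)" for v
    by (rule Ck_on_cong[OF S, rotated]) (use dirderiv_eqI[OF der] in auto)
  then show ?case using der by (auto simp: differentiable_def)
qed

lemma Ck_on_sum:
  assumes S: "open S" and "\<And>b. b \<in> B \<Longrightarrow> Ck_on k S (f b)"
  shows "Ck_on k S (\<lambda>x. \<Sum>b\<in>B. f b x)"
  using assms(2) by (induction B rule: infinite_finite_induct) (auto intro: Ck_on_const Ck_on_add[OF S])

lemma dirderiv_expand:
  fixes f :: "'a::euclidean_space \<Rightarrow> real"
  assumes "f differentiable (at x)"
  shows "dirderiv f v x = (\<Sum>b\<in>Basis. (v \<bullet> b) * dirderiv f b x)"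
proof -
  have lin: "linear (\<lambda>v. dirderiv f v x)"
    using has_derivative_dirderiv[OF assms] by (rule has_derivative_linear)
  have "dirderiv f (\<Sum>b\<in>Basis. (v \<bullet> b) *\<^sub>R b) x = (\<Sum>b\<in>Basis. (v \<bullet> b) * dirderiv f b x)"
    by (simp add: linear_sum[OF lin] linear_scale[OF lin])
  then show ?thesis by (simp only: euclidean_representation)
qed

text \<open>The derivative of the composite is \<open>dirderiv \<phi>\<close> in the direction
  \<open>dirderiv f v x\<close>, which varies with \<open>x\<close>, whereas \<open>Ck_on\<close>
  speaks of fixed directions. Expanding that direction in \<open>Basis\<close> gives a sum of
  products to which the induction hypothesis applies.\<close>

lemma Ck_on_compose:
  fixes f :: "'a::euclidean_space \<Rightarrow> 'b::euclidean_space" and \<phi> :: "'b \<Rightarrow> real"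
  assumes S: "open S" and "Ck_on k S f" "Ck_on k J \<phi>" and im: "f ` S \<subseteq> J"
  shows "Ck_on k S (\<lambda>x. \<phi> (f x))"
  using assms(2,3)
proof (induction k arbitrary: \<phi>)
  case 0
  then show ?case using im continuous_on_compose2 by auto
next
  case (Suc k)
  have der: "((\<lambda>x. \<phi> (f x)) has_derivative
      (\<lambda>v. \<Sum>b\<in>Basis. (dirderiv f v x \<bullet> b) * dirderiv \<phi> b (f x))) (at x)"
    if x: "x \<in> S" for x
  proof -
    have d\<phi>: "\<phi> differentiable (at (f x))" using Suc.prems im x by auto
    have df: "(f has_derivative (\<lambda>v. dirderiv f v x)) (at x)"
      using Suc.prems x by (intro has_derivative_dirderiv) auto
    show ?thesis
      by (rule has_derivative_eq_rhs[OF has_derivative_compose[OF df has_derivative_dirderiv[OF d\<phi>]]])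
        (intro ext dirderiv_expand d\<phi>)
  qed
  have IH: "Ck_on k S (\<lambda>x. dirderiv \<phi> b (f x))" for b
    by (rule Suc.IH) (use Suc.prems Ck_on_SucD in auto)
  have "Ck_on k S (\<lambda>x. dirderiv f v x \<bullet> b)" for v b
    by (rule Ck_on_bounded_linear_compose[OF bounded_linear_inner_left S]) (use Suc.prems in auto)
  then have "Ck_on k S (\<lambda>x. \<Sum>b\<in>Basis. (dirderiv f v x \<bullet> b) * dirderiv \<phi> b (f x))" for v
    by (intro Ck_on_sum Ck_on_mult[OF S] S IH)
  then have "Ck_on k S (dirderiv (\<lambda>x. \<phi> (f x)) v)" for v
    by (rule Ck_on_cong[OF S, rotated]) (use dirderiv_eqI[OF der] in auto)
  then show ?case using der by (auto simp: differentiable_def)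
qed

lemma smooth_on_const: "smooth_on S (\<lambda>x. c)"
  by (simp add: smooth_on_def Ck_on_const)

lemma smooth_on_bounded_linear_compose:
  "bounded_linear L \<Longrightarrow> open S \<Longrightarrow> smooth_on S f \<Longrightarrow> smooth_on S (\<lambda>x. L (f x))"
  by (simp add: smooth_on_def Ck_on_bounded_linear_compose)

lemma smooth_on_add:
  "open S \<Longrightarrow> smooth_on S f \<Longrightarrow> smooth_on S g \<Longrightarrow> smooth_on S (\<lambda>x. f x + g x)"
  by (simp add: smooth_on_def Ck_on_add)

lemma smooth_on_mult:
  fixes f g :: "'a::euclidean_space \<Rightarrow> real"
  shows "open S \<Longrightarrow> smooth_on S f \<Longrightarrow> smooth_on S g \<Longrightarrow> smooth_on S (\<lambda>x. f x * g x)"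
  by (simp add: smooth_on_def Ck_on_mult)

lemma smooth_on_inverse:
  fixes f :: "'a::euclidean_space \<Rightarrow> real"
  shows "open S \<Longrightarrow> smooth_on S f \<Longrightarrow> (\<And>x. x \<in> S \<Longrightarrow> f x \<noteq> 0) \<Longrightarrow> smooth_on S (\<lambda>x. inverse (f x))"
  by (simp add: smooth_on_def Ck_on_inverse)

lemma smooth_on_compose:
  fixes f :: "'a::euclidean_space \<Rightarrow> 'b::euclidean_space" and \<phi> :: "'b \<Rightarrow> real"
  shows "open S \<Longrightarrow> smooth_on S f \<Longrightarrow> smooth_on J \<phi> \<Longrightarrow> f ` S \<subseteq> J \<Longrightarrow> smooth_on S (\<lambda>x. \<phi> (f x))"
  unfolding smooth_on_def using Ck_on_compose by blast

lemma dirderiv_real_eq_deriv: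
  fixes \<phi> :: "real \<Rightarrow> real"
  assumes "\<phi> differentiable (at t)"
  shows "dirderiv \<phi> v t = deriv \<phi> t * v"
proof -
  have der: "(\<phi> has_derivative (\<lambda>v. dirderiv \<phi> v t)) (at t)"
    using assms by (rule has_derivative_dirderiv)
  have lin: "dirderiv \<phi> v t = dirderiv \<phi> 1 t * v" for v
    using linear_scale[OF has_derivative_linear[OF der], of v 1] by simp
  have "(\<phi> has_field_derivative dirderiv \<phi> 1 t) (at t)"
    unfolding has_field_derivative_def by (rule has_derivative_eq_rhs[OF der]) (intro ext lin)
  then show ?thesis using lin DERIV_imp_deriv by metis
qed

lemma smooth_on_deriv:
  fixes \<phi> :: "real \<Rightarrow> real"
  assumes "open J" "smooth_on J \<phi>"
  shows "smooth_on J (deriv \<phi>)"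
  by (rule smooth_on_cong[OF assms(1) _ smooth_on_dirderiv[OF assms(2), of 1]])
    (use smooth_on_differentiable[OF assms(2)] dirderiv_real_eq_deriv[of \<phi> _ 1] in auto)

lemma dirderiv_compose_real:
  fixes f :: "'a::euclidean_space \<Rightarrow> real" and \<phi> :: "real \<Rightarrow> real"
  assumes "f differentiable (at x)" "\<phi> differentiable (at (f x))"
  shows "dirderiv (\<lambda>x. \<phi> (f x)) v x = deriv \<phi> (f x) * dirderiv f v x"
  using dirderiv_eqI[OF has_derivative_compose[OF assms[THEN has_derivative_dirderiv]], of v]
    dirderiv_real_eq_deriv[OF assms(2)] by simp

section \<open>Symmetry of second derivatives\<close>

text \<open>Two mean value theorems, first along \<open>u\<close> and then along \<open>v\<close>.
  The left side of the equation is symmetric in \<open>u\<close> and \<open>v\<close> while the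
  right side is not, which is what makes mixed derivatives comparable.\<close>

lemma second_difference_mean_value:
  fixes f :: "'a::euclidean_space \<Rightarrow> real"
  assumes f: "\<And>y. y \<in> ball x r \<Longrightarrow> f differentiable (at y)"
    and fu: "\<And>y. y \<in> ball x r \<Longrightarrow> dirderiv f u differentiable (at y)"
    and t: "t > 0" "t * (norm u + norm v) < r"
  obtains y where "dist y x \<le> t * (norm u + norm v)"
    "f (x + t *\<^sub>R u + t *\<^sub>R v) - f (x + t *\<^sub>R u) - f (x + t *\<^sub>R v) + f x = t * t * dirderiv (dirderiv f u) v y"
proof -
  have nrm: "norm (a *\<^sub>R u + b *\<^sub>R v) \<le> t * (norm u + norm v)" if "0 \<le> a" "a \<le> t" "0 \<le> b" "b \<le> t" for a b
  proof -
    have "norm (a *\<^sub>R u + b *\<^sub>R v) \<le> a * norm u + b * norm v"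
      using norm_triangle_ineq[of "a *\<^sub>R u" "b *\<^sub>R v"] that by simp
    also have "\<dots> \<le> t * norm u + t * norm v"
      using that by (intro add_mono mult_right_mono) auto
    finally show ?thesis by (simp add: algebra_simps)
  qed
  have inb: "x + a *\<^sub>R u + b *\<^sub>R v \<in> ball x r" if "0 \<le> a" "a \<le> t" "0 \<le> b" "b \<le> t" for a b
  proof -
    have "dist x (x + a *\<^sub>R u + b *\<^sub>R v) = norm (a *\<^sub>R u + b *\<^sub>R v)"
      by (metis add.assoc add_diff_cancel_left' dist_commute dist_norm)
    then show ?thesis using nrm[OF that] t by simp
  qed
  \<comment> \<open>The increment in the direction \<open>v\<close> is frozen at full length, so
    that the second difference is \<open>G t - G 0\<close>.\<close>
  define G where "G a = f (x + a *\<^sub>R u + t *\<^sub>R v) - f (x + a *\<^sub>R u)" for a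
  have derf: "((\<lambda>a. f (x + a *\<^sub>R u + b *\<^sub>R v)) has_real_derivative
      dirderiv f u (x + a *\<^sub>R u + b *\<^sub>R v)) (at a)" if "0 \<le> a" "a \<le> t" "0 \<le> b" "b \<le> t" for a b
  proof -
    have d: "(f has_derivative (\<lambda>w. dirderiv f w (x + a *\<^sub>R u + b *\<^sub>R v))) (at (x + a *\<^sub>R u + b *\<^sub>R v))"
      using f inb[OF that] has_derivative_dirderiv by blast
    have "((\<lambda>a. x + a *\<^sub>R u + b *\<^sub>R v) has_derivative (\<lambda>s. s *\<^sub>R u)) (at a)"
      by (auto intro!: derivative_eq_intros)
    from has_derivative_compose[OF this d] show ?thesis
      using linear_scale[OF has_derivative_linear[OF d]]
      by (simp add: has_field_derivative_def mult_commute_abs)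
  qed
  have "\<exists>a. 0 < a \<and> a < t \<and> G t - G 0 =
      (t - 0) * (dirderiv f u (x + a *\<^sub>R u + t *\<^sub>R v) - dirderiv f u (x + a *\<^sub>R u))"
    unfolding G_def by (rule MVT2) (use t derf[where b=t] derf[where b=0] in \<open>auto intro!: DERIV_diff\<close>)
  then obtain a where a: "0 < a" "a < t" and Ga: "G t - G 0 =
      t * (dirderiv f u (x + a *\<^sub>R u + t *\<^sub>R v) - dirderiv f u (x + a *\<^sub>R u))" by auto
  have derfu: "((\<lambda>b. dirderiv f u (x + a *\<^sub>R u + b *\<^sub>R v)) has_real_derivative
      dirderiv (dirderiv f u) v (x + a *\<^sub>R u + b *\<^sub>R v)) (at b)" if "0 \<le> b" "b \<le> t" for b
  proof -
    have d: "(dirderiv f u has_derivative (\<lambda>w. dirderiv (dirderiv f u) w (x + a *\<^sub>R u + b *\<^sub>R v)))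
        (at (x + a *\<^sub>R u + b *\<^sub>R v))"
      using fu inb[of a b] that a has_derivative_dirderiv[of "dirderiv f u"] by simp
    have "((\<lambda>b. x + a *\<^sub>R u + b *\<^sub>R v) has_derivative (\<lambda>s. s *\<^sub>R v)) (at b)"
      by (auto intro!: derivative_eq_intros)
    from has_derivative_compose[OF this d] show ?thesis
      using linear_scale[OF has_derivative_linear[OF d]]
      by (simp add: has_field_derivative_def mult_commute_abs)
  qed
  have "\<exists>b. 0 < b \<and> b < t \<and> dirderiv f u (x + a *\<^sub>R u + t *\<^sub>R v) - dirderiv f u (x + a *\<^sub>R u + 0 *\<^sub>R v) =
      (t - 0) * dirderiv (dirderiv f u) v (x + a *\<^sub>R u + b *\<^sub>R v)"
    by (rule MVT2) (use t derfu in auto)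
  then obtain b where b: "0 < b" "b < t" and "dirderiv f u (x + a *\<^sub>R u + t *\<^sub>R v) - dirderiv f u (x + a *\<^sub>R u) =
      t * dirderiv (dirderiv f u) v (x + a *\<^sub>R u + b *\<^sub>R v)" by auto
  with Ga have "G t - G 0 = t * t * dirderiv (dirderiv f u) v (x + a *\<^sub>R u + b *\<^sub>R v)" by simp
  moreover have "dist (x + a *\<^sub>R u + b *\<^sub>R v) x \<le> t * (norm u + norm v)"
    using nrm[of a b] a b by (simp add: dist_norm algebra_simps)
  ultimately show ?thesis
    by (intro that[of "x + a *\<^sub>R u + b *\<^sub>R v"]) (auto simp: G_def)
qed

text \<open>The second difference is \<open>t * t\<close> times either mixed derivative, taken at
  points near \<open>x\<close>. If the two differed at \<open>x\<close>, continuity would keep them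
  apart nearby.\<close>

lemma dirderiv_commute:
  fixes f :: "'a::euclidean_space \<Rightarrow> real"
  assumes S: "open S" "x \<in> S" and f: "smooth_on S f"
  shows "dirderiv (dirderiv f u) v x = dirderiv (dirderiv f v) u x"
proof (rule ccontr)
  let ?A = "dirderiv (dirderiv f u) v" and ?B = "dirderiv (dirderiv f v) u"
  define \<epsilon> where "\<epsilon> = \<bar>?A x - ?B x\<bar> / 2"
  assume "?A x \<noteq> ?B x"
  then have \<epsilon>: "\<epsilon> > 0" by (simp add: \<epsilon>_def)
  have "continuous_on S (dirderiv (dirderiv f a) b)" for a b
    using f by (intro smooth_on_continuous_on smooth_on_dirderiv)
  then have cont: "continuous (at x) (dirderiv (dirderiv f a) b)" for a b
    using S continuous_on_eq_continuous_at by blast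
  obtain d1 where d1: "d1 > 0" "\<And>y. dist y x < d1 \<Longrightarrow> dist (?A y) (?A x) < \<epsilon>"
    using cont \<epsilon> unfolding continuous_at_eps_delta by blast
  obtain d2 where d2: "d2 > 0" "\<And>y. dist y x < d2 \<Longrightarrow> dist (?B y) (?B x) < \<epsilon>"
    using cont \<epsilon> unfolding continuous_at_eps_delta by blast
  obtain r0 where r0: "r0 > 0" "ball x r0 \<subseteq> S" using S open_contains_ball by blast
  define r where "r = Min {r0, d1, d2}"
  have r: "r > 0" "r \<le> r0" "r \<le> d1" "r \<le> d2" using r0 d1 d2 by (auto simp: r_def)
  \<comment> \<open>The summand 1 keeps the denominator positive when both directions vanish and
    makes the bound by \<open>r\<close> strict.\<close>
  define t where "t = r / (2 * (norm u + norm v + 1))"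
  have t: "t > 0" using r by (simp add: t_def add_nonneg_pos)
  have "t * (norm u + norm v) < t * (2 * (norm u + norm v + 1))"
    using t by (intro mult_strict_left_mono) (auto simp: add_nonneg_pos)
  also have "\<dots> = r"
    using add_nonneg_pos[of "norm u + norm v" 1] unfolding t_def by simp
  finally have tr: "t * (norm u + norm v) < r" .
  have "ball x r \<subseteq> S" using r r0 subset_ball by blast
  then have "f differentiable (at y)" "dirderiv f w differentiable (at y)" if "y \<in> ball x r" for y w
    using that smooth_on_differentiable[OF f] smooth_on_differentiable[OF smooth_on_dirderiv[OF f, of w]] by blast+
  note diff = this
  obtain y where y: "dist y x \<le> t * (norm u + norm v)"
    "f (x + t *\<^sub>R u + t *\<^sub>R v) - f (x + t *\<^sub>R u) - f (x + t *\<^sub>R v) + f x = t * t * ?A y"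
    by (rule second_difference_mean_value[OF diff t tr])
  have tr': "t * (norm v + norm u) < r" using tr by (simp add: add.commute)
  obtain z where z: "dist z x \<le> t * (norm v + norm u)"
    "f (x + t *\<^sub>R v + t *\<^sub>R u) - f (x + t *\<^sub>R v) - f (x + t *\<^sub>R u) + f x = t * t * ?B z"
    by (rule second_difference_mean_value[OF diff t tr'])
  have "t * t * ?A y = t * t * ?B z"
    using y(2) z(2) by (simp add: algebra_simps)
  then have "?A y = ?B z" using t by simp
  moreover have "dist (?A y) (?A x) < \<epsilon>" "dist (?B z) (?B x) < \<epsilon>"
    using d1(2)[of y] d2(2)[of z] y(1) z(1) r tr tr' by auto
  ultimately have "dist (?A x) (?B x) < 2 * \<epsilon>"
    using dist_triangle_half_r[of "?A y" "?A x" "2 * \<epsilon>" "?B x"] by simp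
  then show False by (simp add: \<epsilon>_def dist_real_def)
qed

section \<open>Functions with proportional differentials\<close>

text \<open>
  The map \<open>x \<mapsto> x + (\<tau> x - x \<bullet> e) e\<close> straightens the level sets of \<open>\<tau>\<close> to the hyperplanes orthogonal
  to \<open>e\<close>, and \<open>c\<close> is the image under its local inverse of a line in the direction \<open>e\<close>.
\<close>

lemma transversal_curve:
  fixes \<tau> :: "'a::euclidean_space \<Rightarrow> real"
  assumes S: "open S" "x0 \<in> S" and \<tau>: "smooth_on S \<tau>" and e: "norm e = 1"
    and nz: "\<And>x. x \<in> S \<Longrightarrow> dirderiv \<tau> e x \<noteq> 0"
  obtains V I c where "open V" "x0 \<in> V" "V \<subseteq> S" "open I" "is_interval I" "\<tau> ` V \<subseteq> I"
    "\<And>t. t \<in> I \<Longrightarrow> c t \<in> S"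
    "\<And>t. t \<in> I \<Longrightarrow> (c has_derivative (\<lambda>s. (s / dirderiv \<tau> e (c t)) *\<^sub>R e)) (at t)"
    "\<And>F x. \<lbrakk>smooth_on S F; \<And>x u. x \<in> S \<Longrightarrow> dirderiv \<tau> e x * dirderiv F u x = dirderiv \<tau> u x * dirderiv F e x;
      x \<in> V\<rbrakk> \<Longrightarrow> (F x :: real) = F (c (\<tau> x))"
proof -
  have ee: "e \<bullet> e = 1" using e by (simp add: dot_square_norm)
  define \<Phi> where "\<Phi> x = x + (\<tau> x - x \<bullet> e) *\<^sub>R e" for x
  define D where "D x w = w + (dirderiv \<tau> w x - w \<bullet> e) *\<^sub>R e" for x w
  have der\<tau>: "(\<tau> has_derivative (\<lambda>w. dirderiv \<tau> w x)) (at x)" if "x \<in> S" for x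
    using has_derivative_dirderiv smooth_on_differentiable[OF \<tau> that] by blast
  have der\<Phi>: "(\<Phi> has_derivative D x) (at x)" if "x \<in> S" for x
    unfolding \<Phi>_def D_def by (rule derivative_eq_intros der\<tau>[OF that] refl)+ simp
  have blD: "bounded_linear (D x)" if "x \<in> S" for x
    using der\<Phi>[OF that] has_derivative_bounded_linear by blast
  define \<Phi>' where "\<Phi>' x = Blinfun (D x)" for x
  have \<Phi>': "blinfun_apply (\<Phi>' x) = D x" if "x \<in> S" for x
    using blD[OF that] by (simp add: \<Phi>'_def bounded_linear_Blinfun_apply)
  have cont: "continuous_on S \<Phi>'"
  proof (rule continuous_on_blinfun_componentwise)
    fix i :: 'a
    have "continuous_on S (\<lambda>x. D x i)"
      unfolding D_def by (intro continuous_intros smooth_on_continuous_on smooth_on_dirderiv \<tau>)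
    then show "continuous_on S (\<lambda>x. blinfun_apply (\<Phi>' x) i)"
      using \<Phi>' by (simp cong: continuous_on_cong)
  qed
  \<comment> \<open>Solving \<open>D x0 w = u\<close>: the inner product with \<open>e\<close> gives
    \<open>dirderiv \<tau> w x0 = u \<bullet> e\<close>, and \<open>w\<close> differs from
    \<open>u\<close> by a multiple of \<open>e\<close>, whose coefficient this equation
    determines.\<close>
  define invD where "invD u = u + ((u \<bullet> e - dirderiv \<tau> u x0) / dirderiv \<tau> e x0) *\<^sub>R e" for u
  have bl\<tau>: "bounded_linear (\<lambda>w. dirderiv \<tau> w x0)"
    using der\<tau>[OF S(2)] has_derivative_bounded_linear by blast
  have blinvD: "bounded_linear invD"
    unfolding invD_def divide_inverse
    by (intro bounded_linear_add bounded_linear_ident bounded_linear_scaleR_const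
        bounded_linear_mult_const bounded_linear_sub bl\<tau> bounded_linear_inner_left)
  have lin\<tau>: "dirderiv \<tau> (u + r *\<^sub>R e) x = dirderiv \<tau> u x + r * dirderiv \<tau> e x" if "x \<in> S" for u r x
    using has_derivative_linear[OF der\<tau>[OF that]] by (simp add: linear_add linear_scale)
  have inv: "invD (D x0 w) = w" for w
  proof -
    have "D x0 w \<bullet> e = dirderiv \<tau> w x0"
      using ee by (simp add: D_def inner_add_left)
    moreover have "dirderiv \<tau> (D x0 w) x0 = dirderiv \<tau> w x0 + (dirderiv \<tau> w x0 - w \<bullet> e) * dirderiv \<tau> e x0"
      unfolding D_def by (rule lin\<tau>[OF S(2)])
    ultimately have "(D x0 w \<bullet> e - dirderiv \<tau> (D x0 w) x0) / dirderiv \<tau> e x0 = - (dirderiv \<tau> w x0 - w \<bullet> e)"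
      using nz[OF S(2)] by (simp add: field_simps)
    then have "invD (D x0 w) = D x0 w + (- (dirderiv \<tau> w x0 - w \<bullet> e)) *\<^sub>R e"
      by (simp only: invD_def)
    then show ?thesis by (simp add: D_def scaleR_diff_left)
  qed
  have "Blinfun invD o\<^sub>L \<Phi>' x0 = id_blinfun"
    by (rule blinfun_eqI) (simp add: \<Phi>'[OF S(2)] bounded_linear_Blinfun_apply[OF blinvD] inv)
  moreover have "(\<Phi> has_derivative blinfun_apply (\<Phi>' x)) (at x)" if "x \<in> S" for x
    using der\<Phi> \<Phi>' that by simp
  ultimately obtain U W g g' where UW: "open U" "U \<subseteq> S" "x0 \<in> U" "open W" "\<Phi> x0 \<in> W" "homeomorphism U W \<Phi> g"
    and g: "\<And>y. y \<in> W \<Longrightarrow> (g has_derivative g' y) (at y)"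
      "\<And>y. y \<in> W \<Longrightarrow> g' y = inv (blinfun_apply (\<Phi>' (g y)))"
      "\<And>y. y \<in> W \<Longrightarrow> bij (blinfun_apply (\<Phi>' (g y)))"
    using inverse_function_theorem[OF S(1) _ cont S(2), of \<Phi> "Blinfun invD"] by blast
  have gW: "g y \<in> S" "\<Phi> (g y) = y" if "y \<in> W" for y
    using UW that by (auto simp: homeomorphism_def)
  have Dg': "D (g y) (g' y u) = u" if "y \<in> W" for y u
    using g(2,3)[OF that] \<Phi>' gW[OF that] by (metis bij_inv_eq_iff)
  have \<tau>g': "dirderiv \<tau> (g' y u) (g y) = u \<bullet> e" if "y \<in> W" for y u
  proof -
    have "D (g y) (g' y u) \<bullet> e = dirderiv \<tau> (g' y u) (g y)"
      using ee by (simp add: D_def inner_add_left)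
    then show ?thesis using Dg'[OF that] by simp
  qed
  \<comment> \<open>\<open>\<Phi>\<close> changes points only along \<open>e\<close>, so its inverse
    carries the direction \<open>e\<close> to itself, rescaled by the rate at which \<tau> grows
    along \<open>e\<close>.\<close>
  have g'e: "g' y (s *\<^sub>R e) = (s / dirderiv \<tau> e (g y)) *\<^sub>R e" if "y \<in> W" for y s
  proof -
    define w where "w = g' y (s *\<^sub>R e)"
    have "w + (s - w \<bullet> e) *\<^sub>R e = s *\<^sub>R e"
      using Dg'[OF that, of "s *\<^sub>R e"] \<tau>g'[OF that, of "s *\<^sub>R e"] ee by (simp add: D_def w_def)
    then have w: "w = 0 + (w \<bullet> e) *\<^sub>R e" by (simp add: algebra_simps)
    then have "dirderiv \<tau> w (g y) = dirderiv \<tau> 0 (g y) + (w \<bullet> e) * dirderiv \<tau> e (g y)"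
      using lin\<tau>[OF gW(1)[OF that]] by metis
    moreover have "dirderiv \<tau> 0 (g y) = 0"
      using linear_0[OF has_derivative_linear[OF der\<tau>[OF gW(1)[OF that]]]] .
    moreover have "dirderiv \<tau> w (g y) = s" using \<tau>g'[OF that, of "s *\<^sub>R e"] ee by (simp add: w_def)
    ultimately have "w \<bullet> e = s / dirderiv \<tau> e (g y)"
      using nz[OF gW(1)[OF that]] by (simp add: field_simps)
    then show ?thesis using w unfolding w_def by simp
  qed
  \<comment> \<open>Inside a ball the slices orthogonal to \<open>e\<close> are convex, and the
    values of \<tau> range over an interval of the same radius.\<close>
  obtain r where r: "r > 0" "ball (\<Phi> x0) r \<subseteq> W" using UW open_contains_ball by blast
  define I where "I = ball (\<tau> x0) r"
  define V where "V = U \<inter> \<Phi> -` ball (\<Phi> x0) r"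
  define c where "c t = g (\<Phi> x0 + (t - \<tau> x0) *\<^sub>R e)" for t
  have \<Phi>e: "\<Phi> x \<bullet> e = \<tau> x" for x using ee by (simp add: \<Phi>_def inner_add_left)
  have inball: "\<Phi> x0 + (t - \<tau> x0) *\<^sub>R e \<in> ball (\<Phi> x0) r" if "t \<in> I" for t
    using that e by (simp add: I_def dist_norm abs_minus_commute)
  have \<tau>V: "\<tau> x \<in> I" if "x \<in> V" for x
  proof -
    have "\<bar>\<tau> x - \<tau> x0\<bar> = \<bar>(\<Phi> x - \<Phi> x0) \<bullet> e\<bar>" by (simp add: inner_diff_left \<Phi>e)
    also have "\<dots> \<le> norm (\<Phi> x - \<Phi> x0)" using Cauchy_Schwarz_ineq2[of _ e] e by (metis mult.right_neutral)
    finally show ?thesis using that by (simp add: V_def I_def dist_norm abs_minus_commute norm_minus_commute)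
  qed
  show ?thesis
  proof (rule that[of V I c])
    have "continuous_on U \<Phi>" using UW by (simp add: homeomorphism_def)
    then show "open V"
      unfolding V_def using UW by (intro continuous_open_preimage) auto
    show "x0 \<in> V" "V \<subseteq> S" using UW r by (auto simp: V_def)
    show "open I" "is_interval I" "\<tau> ` V \<subseteq> I"
      using \<tau>V by (auto simp: I_def is_interval_ball_real)
    show "c t \<in> S" if "t \<in> I" for t
      using gW(1) inball[OF that] r by (auto simp: c_def)
    show "(c has_derivative (\<lambda>s. (s / dirderiv \<tau> e (c t)) *\<^sub>R e)) (at t)" if "t \<in> I" for t
    proof -
      have y: "\<Phi> x0 + (t - \<tau> x0) *\<^sub>R e \<in> W" using inball[OF that] r by blast
      have "((\<lambda>t. \<Phi> x0 + (t - \<tau> x0) *\<^sub>R e) has_derivative (\<lambda>s. s *\<^sub>R e)) (at t)"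
        by (auto intro!: derivative_eq_intros)
      from has_derivative_compose[OF this g(1)[OF y]] show ?thesis
        unfolding c_def g'e[OF y] .
    qed
    fix F :: "'a \<Rightarrow> real" and x
    assume F: "smooth_on S F"
      and dep: "\<And>x u. x \<in> S \<Longrightarrow> dirderiv \<tau> e x * dirderiv F u x = dirderiv \<tau> u x * dirderiv F e x"
      and x: "x \<in> V"
    \<comment> \<open>\<open>z\<close> is the point of the line through \<open>\<Phi> x0\<close> at
      the height of \<open>\<Phi> x\<close>. The segment from \<open>z\<close> to
      \<open>\<Phi> x\<close> is orthogonal to \<open>e\<close>, so \<open>g\<close> maps it into a
      level set of \<tau>, along which \<open>dep\<close> makes \<open>F\<close> constant.\<close>
    define z where "z = \<Phi> x0 + (\<tau> x - \<tau> x0) *\<^sub>R e"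
    have z: "z \<in> ball (\<Phi> x0) r" using inball \<tau>V[OF x] by (simp add: z_def)
    have orth: "(\<Phi> x - z) \<bullet> e = 0"
      using ee by (simp add: z_def inner_diff_left inner_add_left \<Phi>e)
    have "((\<lambda>s. F (g (z + s *\<^sub>R (\<Phi> x - z)))) has_real_derivative 0) (at s)" if s: "0 \<le> s" "s \<le> 1" for s
    proof -
      have "(1 - s) *\<^sub>R z + s *\<^sub>R \<Phi> x \<in> ball (\<Phi> x0) r"
        using convexD_alt[OF convex_ball z, of "\<Phi> x" s] s x by (simp add: V_def)
      then have y: "z + s *\<^sub>R (\<Phi> x - z) \<in> W" (is "?y \<in> W")
        using r by (auto simp: algebra_simps)
      let ?w = "g' ?y (\<Phi> x - z)"
      have "dirderiv \<tau> ?w (g ?y) = 0" using \<tau>g'[OF y] orth by simp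
      then have "dirderiv F ?w (g ?y) = 0"
        using dep[OF gW(1)[OF y], of ?w] nz[OF gW(1)[OF y]] by simp
      moreover have "g' ?y (h *\<^sub>R (\<Phi> x - z)) = h *\<^sub>R ?w" for h
        using g(1)[OF y] has_derivative_linear linear_scale by blast
      moreover have dF: "(F has_derivative (\<lambda>w. dirderiv F w (g ?y))) (at (g ?y))"
        using has_derivative_dirderiv smooth_on_differentiable[OF F gW(1)[OF y]] by blast
      ultimately have zero: "dirderiv F (g' ?y (h *\<^sub>R (\<Phi> x - z))) (g ?y) = 0" for h
        using linear_scale[OF has_derivative_linear[OF dF]] by simp
      have "((\<lambda>s. z + s *\<^sub>R (\<Phi> x - z)) has_derivative (\<lambda>h. h *\<^sub>R (\<Phi> x - z))) (at s)"
        by (rule derivative_eq_intros refl)+ simp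
      note der = has_derivative_compose[OF has_derivative_compose[OF this g(1)[OF y]] dF]
      show ?thesis unfolding has_field_derivative_def
        by (rule has_derivative_eq_rhs[OF der]) (simp add: zero fun_eq_iff)
    qed
    then have "F (g (\<Phi> x)) = F (g z)"
      using MVT2[of 0 1 "\<lambda>s. F (g (z + s *\<^sub>R (\<Phi> x - z)))" "\<lambda>_. 0"] by auto
    moreover have "g (\<Phi> x) = x" using x UW by (auto simp: V_def homeomorphism_def)
    ultimately show "F x = F (c (\<tau> x))" by (simp add: c_def z_def)
  qed
qed

text \<open>Along \<open>c\<close> the derivative of \<open>G\<close> is again a smooth function
  composed with \<open>c\<close>, namely \<open>H\<close>, the quotient of the derivatives of
  \<open>G\<close> and \<tau> along \<open>e\<close>. Induction over all \<open>G\<close> at once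
  therefore works from the differential equation of \<open>c\<close> alone.\<close>

lemma smooth_on_transversal_curve:
  fixes \<tau> G :: "'a::euclidean_space \<Rightarrow> real"
  assumes S: "open S" and I: "open I" and \<tau>: "smooth_on S \<tau>" and G: "smooth_on S G"
    and nz: "\<And>x. x \<in> S \<Longrightarrow> dirderiv \<tau> e x \<noteq> 0"
    and c: "\<And>t. t \<in> I \<Longrightarrow> c t \<in> S"
      "\<And>t. t \<in> I \<Longrightarrow> (c has_derivative (\<lambda>s. (s / dirderiv \<tau> e (c t)) *\<^sub>R e)) (at t)"
  shows "smooth_on I (\<lambda>t. G (c t))"
proof -
  have "Ck_on k I (\<lambda>t. G (c t))" if "smooth_on S G" for k and G :: "'a \<Rightarrow> real"
    using that
  proof (induction k arbitrary: G)
    case 0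
    have "continuous_on I c"
      using c(2) has_derivative_continuous continuous_at_imp_continuous_on by blast
    then show ?case
      using continuous_on_compose2[OF smooth_on_continuous_on[OF 0]] c(1) by auto
  next
    case (Suc k)
    define H where "H x = inverse (dirderiv \<tau> e x) * dirderiv G e x" for x
    have H: "smooth_on S H"
      unfolding H_def by (intro smooth_on_mult smooth_on_inverse smooth_on_dirderiv S Suc.prems \<tau> nz)
    have der: "((\<lambda>t. G (c t)) has_derivative (\<lambda>s. s * H (c t))) (at t)" if t: "t \<in> I" for t
    proof -
      have dG: "(G has_derivative (\<lambda>w. dirderiv G w (c t))) (at (c t))"
        using has_derivative_dirderiv smooth_on_differentiable[OF Suc.prems c(1)[OF t]] by blast
      from has_derivative_compose[OF c(2)[OF t] this] show ?thesis
        using linear_scale[OF has_derivative_linear[OF dG]] by (simp add: H_def divide_inverse mult.assoc)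
    qed
    have "Ck_on k I (dirderiv (\<lambda>t. G (c t)) s)" for s
      by (rule Ck_on_cong[OF I _ Ck_on_mult[OF I Ck_on_const[of _ _ s] Suc.IH[OF H]]])
        (use dirderiv_eqI[OF der] in auto)
    then show ?case using der by (auto simp: differentiable_def)
  qed
  then show ?thesis using G by (simp add: smooth_on_def)
qed

section \<open>Calculus of functions in a chart\<close>

lemma matrix_inv_mult:
  fixes A :: "real ^ 'n ^ 'n"
  assumes "invertible A"
  shows matrix_inv_right: "A ** matrix_inv A = mat 1" and matrix_inv_left: "matrix_inv A ** A = mat 1"
  using someI_ex[OF assms[unfolded invertible_def]] by (auto simp: matrix_inv_def)

text \<open>\<open>W\<close> is the whole domain of the chart in the main argument and an overlap of
  two domains for changes of charts. Injectivity is required on the whole domain because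
  \<open>rep\<close> inverts the chart there.\<close>

locale chart_region =
  fixes c :: "('a, 'n::finite) chart" and W :: "'a set"
  assumes inj: "inj_on (map_of_chart c) (dom_of c)"
    and W: "W \<subseteq> dom_of c" and open_image: "open (map_of_chart c ` W)"
begin

abbreviation smooth :: "('a \<Rightarrow> real) \<Rightarrow> bool" where
  "smooth \<equiv> smooth_in_chart c W"

abbreviation rep :: "('a \<Rightarrow> 'b) \<Rightarrow> real ^ 'n \<Rightarrow> 'b" where
  "rep f \<equiv> f \<circ> inv_into (dom_of c) (map_of_chart c)"

lemma inv_chart: "p \<in> W \<Longrightarrow> inv_into (dom_of c) (map_of_chart c) (map_of_chart c p) = p"
  using inj W by (meson inv_into_f_f subsetD)

lemma smooth_iff: "smooth f \<longleftrightarrow> smooth_on (map_of_chart c ` W) (rep f)"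
  by (simp add: smooth_in_chart_def)

lemma rep_differentiable: "smooth f \<Longrightarrow> p \<in> W \<Longrightarrow> rep f differentiable (at (map_of_chart c p))"
  using smooth_on_differentiable by (auto simp: smooth_iff)

lemma smooth_cong: "smooth f \<Longrightarrow> (\<And>p. p \<in> W \<Longrightarrow> f p = g p) \<Longrightarrow> smooth g"
  unfolding smooth_iff by (rule smooth_on_cong[OF open_image]) (auto simp: inv_chart)

lemma partial_cong:
  assumes "p \<in> W" "\<And>q. q \<in> W \<Longrightarrow> f q = g q"
  shows "partial c i f p = partial c i g p"
  unfolding partial_def using assms by (intro dirderiv_cong[OF open_image]) (auto simp: inv_chart)

lemma smooth_const [simp]: "smooth (\<lambda>p. a)"
  by (simp add: smooth_iff o_def smooth_on_const)

lemma smooth_add [simp]: "smooth f \<Longrightarrow> smooth g \<Longrightarrow> smooth (\<lambda>p. f p + g p)"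
  using smooth_on_add[OF open_image] by (simp add: smooth_iff o_def)

lemma smooth_mult [simp]: "smooth f \<Longrightarrow> smooth g \<Longrightarrow> smooth (\<lambda>p. f p * g p)"
  using smooth_on_mult[OF open_image] by (simp add: smooth_iff o_def)

lemma smooth_uminus [simp]: "smooth f \<Longrightarrow> smooth (\<lambda>p. - f p)"
  using smooth_mult[of "\<lambda>_. - 1" f] by simp

lemma smooth_diff [simp]: "smooth f \<Longrightarrow> smooth g \<Longrightarrow> smooth (\<lambda>p. f p - g p)"
  using smooth_add[of f "\<lambda>p. - g p"] by simp

lemma smooth_sum [simp]: "(\<And>i. i \<in> B \<Longrightarrow> smooth (f i)) \<Longrightarrow> smooth (\<lambda>p. \<Sum>i\<in>B. f i p)"
  by (induction B rule: infinite_finite_induct) auto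

lemma smooth_prod [simp]: "(\<And>i. i \<in> B \<Longrightarrow> smooth (f i)) \<Longrightarrow> smooth (\<lambda>p. \<Prod>i\<in>B. f i p)"
  by (induction B rule: infinite_finite_induct) auto

lemma smooth_divide:
  assumes "smooth f" "smooth g" and nz: "\<And>p. p \<in> W \<Longrightarrow> g p \<noteq> 0"
  shows "smooth (\<lambda>p. f p / g p)"
proof -
  have "smooth_on (map_of_chart c ` W) (\<lambda>x. inverse (rep g x))"
    using assms by (intro smooth_on_inverse[OF open_image]) (auto simp: smooth_iff o_def inv_chart)
  then have "smooth (\<lambda>p. inverse (g p))" by (simp add: smooth_iff o_def)
  then show ?thesis using smooth_mult assms(1) unfolding divide_inverse by blast
qed

lemma smooth_compose:
  assumes "smooth f" "smooth_on J \<phi>" "f ` W \<subseteq> J"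
  shows "smooth (\<lambda>p. \<phi> (f p))"
  using smooth_on_compose[OF open_image, of "rep f" J \<phi>] assms
  by (auto simp: smooth_iff o_def inv_chart image_subset_iff)

lemma smooth_partial [simp]: "smooth f \<Longrightarrow> smooth (partial c i f)"
  unfolding smooth_iff
  by (rule smooth_on_cong[OF open_image _ smooth_on_dirderiv[of _ "rep f" "axis i 1"]])
    (auto simp: inv_chart partial_def)

lemma partial_const [simp]: "partial c i (\<lambda>p. a) p = 0"
  by (simp add: partial_def o_def)

lemma partial_add [simp]:
  assumes "p \<in> W" "smooth f" "smooth g"
  shows "partial c i (\<lambda>p. f p + g p) p = partial c i f p + partial c i g p"
proof -
  have "((\<lambda>x. rep f x + rep g x) has_derivative
    (\<lambda>v. dirderiv (rep f) v (map_of_chart c p) + dirderiv (rep g) v (map_of_chart c p))) (at (map_of_chart c p))"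
    using assms by (intro has_derivative_add has_derivative_dirderiv rep_differentiable)
  from dirderiv_eqI[OF this] show ?thesis by (simp add: partial_def o_def)
qed

lemma partial_mult [simp]:
  assumes "p \<in> W" "smooth f" "smooth g"
  shows "partial c i (\<lambda>p. f p * g p) p = partial c i f p * g p + f p * partial c i g p"
proof -
  let ?x = "map_of_chart c p"
  have "((\<lambda>x. rep f x * rep g x) has_derivative
    (\<lambda>v. rep f ?x * dirderiv (rep g) v ?x + dirderiv (rep f) v ?x * rep g ?x)) (at ?x)"
    using assms by (intro has_derivative_mult has_derivative_dirderiv rep_differentiable)
  from dirderiv_eqI[OF this] show ?thesis using assms(1) by (simp add: partial_def o_def inv_chart)
qed

lemma partial_uminus [simp]:
  "p \<in> W \<Longrightarrow> smooth f \<Longrightarrow> partial c i (\<lambda>p. - f p) p = - partial c i f p"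
  using partial_mult[of p "\<lambda>_. - 1" f i] by simp

lemma partial_diff [simp]:
  "p \<in> W \<Longrightarrow> smooth f \<Longrightarrow> smooth g \<Longrightarrow> partial c i (\<lambda>p. f p - g p) p = partial c i f p - partial c i g p"
  using partial_add[of p f "\<lambda>p. - g p" i] by simp

lemma partial_sum [simp]:
  "p \<in> W \<Longrightarrow> (\<And>k. k \<in> B \<Longrightarrow> smooth (f k)) \<Longrightarrow>
    partial c i (\<lambda>p. \<Sum>k\<in>B. f k p) p = (\<Sum>k\<in>B. partial c i (f k) p)"
  by (induction B rule: infinite_finite_induct) auto

lemma partial_compose:
  assumes "p \<in> W" "smooth f" "\<phi> differentiable (at (f p))"
  shows "partial c i (\<lambda>p. \<phi> (f p)) p = deriv \<phi> (f p) * partial c i f p"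
  using dirderiv_compose_real[OF rep_differentiable, of f p \<phi>] assms
  by (simp add: partial_def o_def inv_chart)

lemma partial_commute:
  assumes "p \<in> W" "smooth f"
  shows "partial c i (partial c j f) p = partial c j (partial c i f) p"
proof -
  have "partial c i (partial c j f) p = dirderiv (dirderiv (rep f) (axis j 1)) (axis i 1) (map_of_chart c p)"
    for i j
    unfolding partial_def[of c i]
    using assms by (intro dirderiv_cong[OF open_image]) (auto simp: partial_def inv_chart)
  then show ?thesis
    using dirderiv_commute[OF open_image, of _ "rep f"] assms by (simp add: smooth_iff)
qed

lemma smooth_det:
  fixes M :: "'a \<Rightarrow> real ^ 'm ^ 'm"
  assumes "\<And>i j. smooth (\<lambda>p. M p $ i $ j)"
  shows "smooth (\<lambda>p. det (M p))"
  unfolding det_def using assms by simp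

text \<open>Cramer's rule: \<open>A\<close> is \<open>M\<close> with column \<open>k\<close>
  replaced by the \<open>l\<close>-th unit vector, and an entry of the inverse is a quotient of
  determinants, which are polynomial in the entries.\<close>

lemma smooth_matrix_inv:
  fixes M :: "'a \<Rightarrow> real ^ 'm ^ 'm"
  assumes M: "\<And>i j. smooth (\<lambda>p. M p $ i $ j)" and inv: "\<And>p. p \<in> W \<Longrightarrow> invertible (M p)"
  shows "smooth (\<lambda>p. matrix_inv (M p) $ k $ l)"
proof -
  define A where "A p = (\<chi> i j. if j = k then axis l 1 $ i else M p $ i $ j :: real ^ 'm ^ 'm)" for p
  have "smooth (\<lambda>p. A p $ i $ j)" for i j
    using M by (cases "j = k") (simp_all add: A_def)
  note A = this
  have det: "det (M p) \<noteq> 0" if "p \<in> W" for p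
    using inv[OF that] invertible_det_nz by blast
  have "smooth (\<lambda>p. det (A p) / det (M p))"
    using M A det by (intro smooth_divide smooth_det)
  moreover have "det (A p) / det (M p) = matrix_inv (M p) $ k $ l" if "p \<in> W" for p
  proof -
    have "M p *v (matrix_inv (M p) *v axis l 1) = axis l 1"
      using matrix_inv_right[OF inv[OF that]] by (simp add: matrix_vector_mul_assoc)
    then have "matrix_inv (M p) *v axis l 1 = (\<chi> k. det (\<chi> i j. if j = k then axis l 1 $ i else M p $ i $ j) / det (M p))"
      using cramer[OF det[OF that]] by blast
    then have "(matrix_inv (M p) *v axis l 1) $ k = det (A p) / det (M p)"
      by (simp add: A_def)
    then show ?thesis by (simp add: matrix_vector_mul_component inner_axis)
  qed
  ultimately show ?thesis by (rule smooth_cong)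
qed

end

section \<open>Matrix-valued functions and their partial derivatives\<close>

lemma matrix_mult_distribs:
  fixes A B C :: "real ^ 'n ^ 'n"
  shows "(A + B) ** C = A ** C + B ** C" "A ** (B + C) = A ** B + A ** C"
    "(A - B) ** C = A ** C - B ** C" "A ** (B - C) = A ** B - A ** C"
    "(- A) ** B = - (A ** B)" "A ** (- B) = - (A ** B)"
  by (simp_all add: vec_eq_iff matrix_matrix_mult_def sum.distrib sum_subtractf sum_negf algebra_simps)

lemma transpose_distribs:
  fixes A B :: "real ^ 'n ^ 'n"
  shows "transpose (A + B) = transpose A + transpose B" "transpose (A - B) = transpose A - transpose B"
    "transpose (- A) = - transpose A"
  by (simp_all add: vec_eq_iff transpose_def)

context chart_region
begin

abbreviation smooth_mat :: "('a \<Rightarrow> real ^ 'm ^ 'm) \<Rightarrow> bool" where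
  "smooth_mat M \<equiv> \<forall>k l. smooth (\<lambda>p. M p $ k $ l)"

definition dmat :: "'n \<Rightarrow> ('a \<Rightarrow> real ^ 'm ^ 'm) \<Rightarrow> 'a \<Rightarrow> real ^ 'm ^ 'm" where
  "dmat i M p = (\<chi> k l. partial c i (\<lambda>q. M q $ k $ l) p)"

lemma smooth_mat_dmat [simp]: "smooth_mat M \<Longrightarrow> smooth_mat (dmat i M)"
  by (simp add: dmat_def)

lemma smooth_mat_mult [simp]: "smooth_mat M \<Longrightarrow> smooth_mat N \<Longrightarrow> smooth_mat (\<lambda>p. M p ** N p)"
  by (simp add: matrix_matrix_mult_def)

lemma smooth_mat_add [simp]: "smooth_mat M \<Longrightarrow> smooth_mat N \<Longrightarrow> smooth_mat (\<lambda>p. M p + N p)"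
  by simp

lemma smooth_mat_diff [simp]: "smooth_mat M \<Longrightarrow> smooth_mat N \<Longrightarrow> smooth_mat (\<lambda>p. M p - N p)"
  by simp

lemma dmat_add: "p \<in> W \<Longrightarrow> smooth_mat M \<Longrightarrow> smooth_mat N \<Longrightarrow>
    dmat i (\<lambda>p. M p + N p) p = dmat i M p + dmat i N p"
  by (simp add: dmat_def vec_eq_iff)

lemma dmat_diff: "p \<in> W \<Longrightarrow> smooth_mat M \<Longrightarrow> smooth_mat N \<Longrightarrow>
    dmat i (\<lambda>p. M p - N p) p = dmat i M p - dmat i N p"
  by (simp add: dmat_def vec_eq_iff)

lemma dmat_mult: "p \<in> W \<Longrightarrow> smooth_mat M \<Longrightarrow> smooth_mat N \<Longrightarrow>
    dmat i (\<lambda>p. M p ** N p) p = dmat i M p ** N p + M p ** dmat i N p"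
  by (simp add: dmat_def vec_eq_iff matrix_matrix_mult_def sum.distrib)

lemma dmat_transpose: "dmat i (\<lambda>p. transpose (M p)) p = transpose (dmat i M p)"
  by (simp add: dmat_def vec_eq_iff transpose_def)

lemma dmat_commute: "p \<in> W \<Longrightarrow> smooth_mat M \<Longrightarrow> dmat i (dmat j M) p = dmat j (dmat i M) p"
  by (simp add: dmat_def vec_eq_iff partial_commute[of p _ i j])

lemma dmat_cong: "p \<in> W \<Longrightarrow> (\<And>q. q \<in> W \<Longrightarrow> M q = N q) \<Longrightarrow> dmat i M p = dmat i N p"
  by (auto simp: dmat_def vec_eq_iff intro!: partial_cong)

end

section \<open>Curvature identities in a chart\<close>

text \<open>
  Here \<open>h\<close> stands for the inverse metric, and row \<open>k\<close>, column \<open>j\<close> of \<open>\<Gamma> i p\<close> for the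
  Christoffel symbol \<open>\<Gamma>\<^sup>k\<^sub>i\<^sub>j\<close>, so that covariant differentiation of vector fields along \<open>\<partial>\<^sub>i\<close> is
  \<open>\<partial>\<^sub>i + \<Gamma> i\<close>.
\<close>

locale chart_connection = chart_region c W
  for c :: "('a, 'n::finite) chart" and W :: "'a set" +
  fixes h :: "'a \<Rightarrow> real ^ 'n ^ 'n" and \<Gamma> :: "'n \<Rightarrow> 'a \<Rightarrow> real ^ 'n ^ 'n"
  assumes smooth_h: "smooth_mat h" and smooth_\<Gamma>: "smooth_mat (\<Gamma> i)"
    and torsion: "p \<in> W \<Longrightarrow> \<Gamma> i p $ k $ j = \<Gamma> j p $ k $ i"
    and h_sym: "p \<in> W \<Longrightarrow> transpose (h p) = h p"
    and dh: "p \<in> W \<Longrightarrow> dmat i h p = - (\<Gamma> i p ** h p) - h p ** transpose (\<Gamma> i p)"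
begin

text \<open>The commutator of the operators \<partial> + \<Gamma> in the directions \<open>i\<close>
  and \<open>j\<close>, that is, the matrix of R(\<partial>\<open>\<^sub>i\<close>,
  \<partial>\<open>\<^sub>j\<close>); its row is the upper index \<open>l\<close> of
  \<open>curvature\<close>, its column the index \<open>k\<close>.\<close>

definition curv :: "'n \<Rightarrow> 'n \<Rightarrow> 'a \<Rightarrow> real ^ 'n ^ 'n" where
  "curv i j p = dmat i (\<Gamma> j) p - dmat j (\<Gamma> i) p + (\<Gamma> i p ** \<Gamma> j p - \<Gamma> j p ** \<Gamma> i p)"

lemma smooth_curv: "smooth_mat (curv i j)"
  unfolding curv_def using smooth_\<Gamma>
  by (intro smooth_mat_add smooth_mat_diff smooth_mat_mult smooth_mat_dmat) auto

lemma dmat_curv: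
  assumes "p \<in> W"
  shows "dmat m (curv i j) p = dmat m (dmat i (\<Gamma> j)) p - dmat m (dmat j (\<Gamma> i)) p +
    (dmat m (\<Gamma> i) p ** \<Gamma> j p + \<Gamma> i p ** dmat m (\<Gamma> j) p - dmat m (\<Gamma> j) p ** \<Gamma> i p - \<Gamma> j p ** dmat m (\<Gamma> i) p)"
proof -
  have "smooth_mat (dmat i (\<Gamma> j))" "smooth_mat (\<lambda>p. \<Gamma> i p ** \<Gamma> j p)" for i j
    using smooth_\<Gamma> by (intro smooth_mat_dmat smooth_mat_mult; simp)+
  note S = this
  have "dmat m (curv i j) p = dmat m (\<lambda>p. (dmat i (\<Gamma> j) p - dmat j (\<Gamma> i) p) + (\<Gamma> i p ** \<Gamma> j p - \<Gamma> j p ** \<Gamma> i p)) p"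
    by (simp add: curv_def[abs_def])
  also have "\<dots> = dmat m (dmat i (\<Gamma> j)) p - dmat m (dmat j (\<Gamma> i)) p +
      (dmat m (\<lambda>p. \<Gamma> i p ** \<Gamma> j p) p - dmat m (\<lambda>p. \<Gamma> j p ** \<Gamma> i p) p)"
    using assms S by (subst dmat_add; (intro smooth_mat_diff S)?; simp add: dmat_diff)
  finally show ?thesis
    using assms smooth_\<Gamma> by (simp add: dmat_mult)
qed

text \<open>The Jacobi identity for the three operators \<partial> + \<Gamma>. The Christoffel terms
  that full covariant derivatives would have on the indices \<open>i\<close>, \<open>j\<close>,
  \<open>m\<close> cancel in the cyclic sum for a symmetric connection, so they are left out from
  the start.\<close>

lemma second_bianchi:
  assumes p: "p \<in> W"
  shows "(dmat m (curv i j) p + \<Gamma> m p ** curv i j p - curv i j p ** \<Gamma> m p) +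
    (dmat i (curv j m) p + \<Gamma> i p ** curv j m p - curv j m p ** \<Gamma> i p) +
    (dmat j (curv m i) p + \<Gamma> j p ** curv m i p - curv m i p ** \<Gamma> j p) = 0"
proof -
  have comm: "dmat i (dmat j (\<Gamma> k)) p = dmat j (dmat i (\<Gamma> k)) p" for i j k
    using dmat_commute[OF p] smooth_\<Gamma> by blast
  show ?thesis
    unfolding dmat_curv[OF p] curv_def comm[of m i j] comm[of m j i] comm[of i j m]
    by (simp add: matrix_mult_distribs matrix_mul_assoc algebra_simps)
qed

text \<open>Raising the column index makes the skewness of the curvature plain skewness of a matrix
  and allows the later traces to be taken without the metric.\<close>

definition curv_up :: "'n \<Rightarrow> 'n \<Rightarrow> 'a \<Rightarrow> real ^ 'n ^ 'n" where
  "curv_up i j p = curv i j p ** h p"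

lemma smooth_curv_up: "smooth_mat (curv_up i j)"
  unfolding curv_up_def using smooth_curv smooth_h by (intro smooth_mat_mult) auto

lemma curv_antisym: "curv j i p = - curv i j p"
  by (simp add: curv_def)

lemma curv_up_antisym: "curv_up j i p $ k $ l = - curv_up i j p $ k $ l"
  by (simp add: curv_up_def curv_antisym[of j i] matrix_mult_distribs)

text \<open>The curvature is skew because the second derivatives of the inverse metric commute.\<close>

lemma curv_up_skew:
  assumes p: "p \<in> W"
  shows "curv_up i j p $ l $ k = - curv_up i j p $ k $ l"
proof -
  have T: "smooth_mat (\<lambda>p. transpose (\<Gamma> i p))" for i
    using smooth_\<Gamma> by (simp add: transpose_def)
  have dd: "dmat i (dmat j h) p = - (dmat i (\<Gamma> j) p ** h p) - \<Gamma> j p ** dmat i h p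
      - dmat i h p ** transpose (\<Gamma> j p) - h p ** transpose (dmat i (\<Gamma> j) p)" for i j
  proof -
    \<comment> \<open>The zero function turns the leading minus sign into a difference, so that
      \<open>dmat_diff\<close> applies.\<close>
    have "dmat i (dmat j h) p = dmat i (\<lambda>p. (\<lambda>_. 0) p - \<Gamma> j p ** h p - h p ** transpose (\<Gamma> j p)) p"
      by (rule dmat_cong[OF p]) (simp add: dh)
    also have "\<dots> = dmat i (\<lambda>_. 0) p - dmat i (\<lambda>p. \<Gamma> j p ** h p) p - dmat i (\<lambda>p. h p ** transpose (\<Gamma> j p)) p"
      using p smooth_h smooth_\<Gamma> T
      by (subst dmat_diff; (intro smooth_mat_diff smooth_mat_mult)?; (subst dmat_diff)?; (intro smooth_mat_mult)?; simp)
    also have "dmat i (\<lambda>_. 0) p = 0" by (simp add: dmat_def vec_eq_iff)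
    finally show ?thesis
      using p smooth_h smooth_\<Gamma> T by (simp add: dmat_mult dmat_transpose)
  qed
  have "dmat i (dmat j h) p = dmat j (dmat i h) p"
    using dmat_commute[OF p] smooth_h by blast
  \<comment> \<open>In the commutator of the second derivatives the mixed terms, with \<Gamma> on
    the left and a transposed \<Gamma> on the right of \<open>h p\<close>, cancel; what remains is
    minus this sum.\<close>
  then have "curv_up i j p + transpose (curv_up i j p) = 0"
    unfolding dd dh[OF p] curv_up_def curv_def
    by (simp add: matrix_mult_distribs transpose_distribs matrix_transpose_mul h_sym[OF p] matrix_mul_assoc algebra_simps)
  then have "(curv_up i j p + transpose (curv_up i j p)) $ k $ l = 0" by simp
  then show ?thesis by (simp add: transpose_def)
qed

text \<open>The inverse metric is parallel: by \<open>dh\<close>, its derivative turns the right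
  factor \<Gamma> of \<open>second_bianchi\<close> into a transposed \<Gamma> behind
  \<open>curv_up\<close>, so the identity is just multiplied by \<open>h p\<close>.\<close>

lemma second_bianchi_up:
  assumes p: "p \<in> W"
  shows "(dmat m (curv_up i j) p + \<Gamma> m p ** curv_up i j p + curv_up i j p ** transpose (\<Gamma> m p)) +
    (dmat i (curv_up j m) p + \<Gamma> i p ** curv_up j m p + curv_up j m p ** transpose (\<Gamma> i p)) +
    (dmat j (curv_up m i) p + \<Gamma> j p ** curv_up m i p + curv_up m i p ** transpose (\<Gamma> j p)) = 0"
proof -
  have "dmat m (curv_up i j) p + \<Gamma> m p ** curv_up i j p + curv_up i j p ** transpose (\<Gamma> m p) =
    (dmat m (curv i j) p + \<Gamma> m p ** curv i j p - curv i j p ** \<Gamma> m p) ** h p" for m i j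
    unfolding curv_up_def using p smooth_curv smooth_h
    by (simp add: dmat_mult dh matrix_mult_distribs matrix_mul_assoc algebra_simps)
  then show ?thesis
    using arg_cong[OF second_bianchi[OF p, of m i j], of "\<lambda>M. M ** h p"]
    by (simp add: matrix_mult_distribs(1))
qed

text \<open>
  For a 1-form \<open>X\<close> with values in vector fields, \<open>X j k\<close> being the \<open>k\<close>-th component of \<open>X(\<partial>\<^sub>j)\<close>,
  this is the contraction of the exterior covariant derivative of \<open>X\<close>.
\<close>

definition contracted_d :: "('n \<Rightarrow> 'n \<Rightarrow> 'a \<Rightarrow> real) \<Rightarrow> 'n \<Rightarrow> 'a \<Rightarrow> real" where
  "contracted_d X j p = (\<Sum>i\<in>UNIV.
     (partial c i (X j i) p + (\<Sum>a\<in>UNIV. \<Gamma> i p $ i $ a * X j a p)) -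
     (partial c j (X i i) p + (\<Sum>a\<in>UNIV. \<Gamma> j p $ i $ a * X i a p)))"

definition ric_up :: "'n \<Rightarrow> 'n \<Rightarrow> 'a \<Rightarrow> real" where
  "ric_up j k p = (\<Sum>i\<in>UNIV. curv_up i j p $ i $ k)"

lemma smooth_ric_up: "smooth (ric_up j k)"
  unfolding ric_up_def using smooth_curv_up by simp

lemma partial_ric_up: "p \<in> W \<Longrightarrow> partial c m (ric_up j k) p = (\<Sum>i\<in>UNIV. dmat m (curv_up i j) p $ i $ k)"
  unfolding ric_up_def using smooth_curv_up by (simp add: dmat_def)

text \<open>A double trace of \<open>second_bianchi_up\<close>. Two of its three cyclic groups give
  minus the divergence of the Ricci tensor each, the third the differential of the scalar
  curvature.\<close>

lemma contracted_bianchi: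
  assumes p: "p \<in> W"
  shows "2 * contracted_d ric_up j p = - partial c j (\<lambda>p. \<Sum>i\<in>UNIV. ric_up i i p) p"
proof -
  let ?K = "\<lambda>i j. curv_up i j p"
  have skew: "?K i j $ a $ b = - ?K i j $ b $ a" for i j a b
    by (rule curv_up_skew[OF p])
  have anti: "?K i j $ a $ b = - ?K j i $ a $ b" for i j a b
    by (rule curv_up_antisym)
  have dskew: "dmat m (curv_up i j) p $ a $ b = - dmat m (curv_up i j) p $ b $ a" for m i j a b
  proof -
    have "dmat m (curv_up i j) p $ a $ b = partial c m (\<lambda>p. - curv_up i j p $ b $ a) p"
      unfolding dmat_def vec_lambda_beta by (rule partial_cong[OF p]) (rule curv_up_skew)
    then show ?thesis using p smooth_curv_up by (simp add: dmat_def)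
  qed
  have danti: "dmat m (curv_up i j) p $ a $ b = - dmat m (curv_up j i) p $ a $ b" for m i j a b
  proof -
    have "dmat m (curv_up i j) p $ a $ b = partial c m (\<lambda>p. - curv_up j i p $ a $ b) p"
      unfolding dmat_def vec_lambda_beta by (rule partial_cong[OF p]) (rule curv_up_antisym)
    then show ?thesis using p smooth_curv_up by (simp add: dmat_def)
  qed
  define dv where "dv = (\<Sum>m\<in>UNIV. partial c m (ric_up j m) p + (\<Sum>a\<in>UNIV. \<Gamma> m p $ m $ a * ric_up j a p))"
  define gr where "gr = (\<Sum>m\<in>UNIV. partial c j (ric_up m m) p)"
  define cr where "cr = (\<Sum>m\<in>UNIV. \<Sum>a\<in>UNIV. \<Gamma> j p $ m $ a * ric_up m a p)"
  \<comment> \<open>For terms pairing the lower indices of a Christoffel symbol, symmetric by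
    torsion-freeness, with a skew pair of curvature indices.\<close>
  have symskew: "(\<Sum>m\<in>UNIV. \<Sum>a\<in>UNIV. G m a * X m a) = 0"
    if "\<And>m a. G m a = G a m" "\<And>m a. X m a = - X a m" for G X :: "'n \<Rightarrow> 'n \<Rightarrow> real"
  proof -
    have "(\<Sum>m\<in>UNIV. \<Sum>a\<in>UNIV. G m a * X m a) = (\<Sum>m\<in>UNIV. \<Sum>a\<in>UNIV. G a m * X a m)"
      by (rule sum.swap)
    also have "\<dots> = (\<Sum>m\<in>UNIV. \<Sum>a\<in>UNIV. - (G m a * X m a))"
      by (intro sum.cong refl) (metis that mult_minus_right)
    finally show ?thesis by (simp add: sum_negf)
  qed
  \<comment> \<open>The facts 1 to 9 evaluate the nine summands of \<open>second_bianchi_up\<close>,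
    in their order there, at row \<open>m\<close> and column \<open>i\<close>, summed over
    both.\<close>
  have 1: "(\<Sum>m\<in>UNIV. \<Sum>i\<in>UNIV. dmat m (curv_up i j) p $ m $ i) = - (\<Sum>m\<in>UNIV. partial c m (ric_up j m) p)"
    by (simp add: dskew[of m _ j m _ for m] partial_ric_up[OF p] sum_negf)
  have 2: "(\<Sum>m\<in>UNIV. \<Sum>i\<in>UNIV. (\<Gamma> m p ** ?K i j) $ m $ i) = - (\<Sum>m\<in>UNIV. \<Sum>a\<in>UNIV. \<Gamma> m p $ m $ a * ric_up j a p)"
  proof -
    have "(\<Sum>i\<in>UNIV. (\<Gamma> m p ** ?K i j) $ m $ i) = - (\<Sum>a\<in>UNIV. \<Gamma> m p $ m $ a * ric_up j a p)" for m
      unfolding ric_up_def sum_distrib_left sum_negf[symmetric]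
      by (subst sum.swap) (simp add: matrix_matrix_mult_def skew[of i j a i for i a] sum_negf)
    then show ?thesis by (simp add: sum_negf)
  qed
  have 3: "(\<Sum>m\<in>UNIV. \<Sum>i\<in>UNIV. (?K i j ** transpose (\<Gamma> m p)) $ m $ i) = 0"
  proof -
    have "(\<Sum>m\<in>UNIV. \<Sum>a\<in>UNIV. \<Gamma> m p $ i $ a * ?K i j $ m $ a) = 0" for i
      using torsion[OF p] skew by (intro symskew) blast+
    then show ?thesis
      by (subst sum.swap) (simp add: matrix_matrix_mult_def transpose_def mult.commute)
  qed
  have 4: "(\<Sum>m\<in>UNIV. \<Sum>i\<in>UNIV. dmat i (curv_up j m) p $ m $ i) = - (\<Sum>m\<in>UNIV. partial c m (ric_up j m) p)"
    by (subst sum.swap) (simp add: danti[of i j m m i for m i] partial_ric_up[OF p] sum_negf)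
  have 5: "(\<Sum>m\<in>UNIV. \<Sum>i\<in>UNIV. (\<Gamma> i p ** ?K j m) $ m $ i) = 0"
  proof -
    have "(\<Sum>i\<in>UNIV. \<Sum>a\<in>UNIV. \<Gamma> i p $ m $ a * ?K j m $ a $ i) = 0" for m
      using torsion[OF p] skew by (intro symskew) blast+
    then show ?thesis
      by (simp add: matrix_matrix_mult_def)
  qed
  have 6: "(\<Sum>m\<in>UNIV. \<Sum>i\<in>UNIV. (?K j m ** transpose (\<Gamma> i p)) $ m $ i) = - (\<Sum>m\<in>UNIV. \<Sum>a\<in>UNIV. \<Gamma> m p $ m $ a * ric_up j a p)"
  proof -
    have "(\<Sum>m\<in>UNIV. (?K j m ** transpose (\<Gamma> i p)) $ m $ i) = - (\<Sum>a\<in>UNIV. \<Gamma> i p $ i $ a * ric_up j a p)" for i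
      unfolding ric_up_def sum_distrib_left sum_negf[symmetric]
      by (subst sum.swap) (simp add: matrix_matrix_mult_def transpose_def anti[of j m m a for m a] mult.commute)
    then show ?thesis by (subst sum.swap) (simp add: sum_negf)
  qed
  have 7: "(\<Sum>m\<in>UNIV. \<Sum>i\<in>UNIV. dmat j (curv_up m i) p $ m $ i) = gr"
    unfolding gr_def by (subst sum.swap) (simp add: partial_ric_up[OF p])
  have 8: "(\<Sum>m\<in>UNIV. \<Sum>i\<in>UNIV. (\<Gamma> j p ** ?K m i) $ m $ i) = cr"
  proof -
    have "?K m i $ a $ i = ?K i m $ i $ a" for m i a
      using skew[of m i a i] anti[of m i i a] by simp
    then have "(\<Sum>i\<in>UNIV. (\<Gamma> j p ** ?K m i) $ m $ i) = (\<Sum>a\<in>UNIV. \<Gamma> j p $ m $ a * ric_up m a p)" for m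
      unfolding ric_up_def sum_distrib_left
      by (subst sum.swap) (simp add: matrix_matrix_mult_def)
    then show ?thesis by (simp add: cr_def)
  qed
  have 9: "(\<Sum>m\<in>UNIV. \<Sum>i\<in>UNIV. (?K m i ** transpose (\<Gamma> j p)) $ m $ i) = cr"
  proof -
    have "(\<Sum>m\<in>UNIV. (?K m i ** transpose (\<Gamma> j p)) $ m $ i) = (\<Sum>a\<in>UNIV. \<Gamma> j p $ i $ a * ric_up i a p)" for i
      unfolding ric_up_def sum_distrib_left
      by (subst sum.swap) (simp add: matrix_matrix_mult_def transpose_def mult.commute)
    then show ?thesis by (subst sum.swap) (simp add: cr_def)
  qed
  have "(\<Sum>m\<in>UNIV. \<Sum>i\<in>UNIV.
    ((dmat m (curv_up i j) p + \<Gamma> m p ** ?K i j + ?K i j ** transpose (\<Gamma> m p)) +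
    (dmat i (curv_up j m) p + \<Gamma> i p ** ?K j m + ?K j m ** transpose (\<Gamma> i p)) +
    (dmat j (curv_up m i) p + \<Gamma> j p ** ?K m i + ?K m i ** transpose (\<Gamma> j p))) $ m $ i) = 0"
    unfolding second_bianchi_up[OF p] by simp
  \<comment> \<open>\<open>cr\<close> is the Christoffel term on the lower index \<open>j\<close>
    that \<open>dv\<close> lacks: \<open>dv - cr\<close> is the full divergence, and the equation
    says that twice it is \<open>gr\<close>.\<close>
  then have "- 2 * dv + gr + 2 * cr = 0"
    unfolding vector_add_component sum.distrib 1 2 3 4 5 6 7 8 9 by (simp add: dv_def sum.distrib)
  moreover have "contracted_d ric_up j p = dv - (gr + cr)"
    by (simp add: contracted_d_def dv_def gr_def cr_def sum.distrib sum_subtractf)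
  moreover have "partial c j (\<lambda>p. \<Sum>i\<in>UNIV. ric_up i i p) p = gr"
    using p smooth_ric_up by (simp add: gr_def)
  ultimately show ?thesis by simp
qed

section \<open>Contracted exterior derivatives of the terms of the equation\<close>

definition cov :: "('n \<Rightarrow> 'a \<Rightarrow> real) \<Rightarrow> 'n \<Rightarrow> 'n \<Rightarrow> 'a \<Rightarrow> real" where
  "cov v j k p = partial c j (v k) p + (\<Sum>a\<in>UNIV. \<Gamma> j p $ k $ a * v a p)"

lemma smooth_cov: "(\<And>k. smooth (v k)) \<Longrightarrow> smooth (cov v j k)"
  unfolding cov_def using smooth_\<Gamma> by simp

text \<open>The exterior covariant derivative of \<nabla>v is the curvature applied to v, and its
  contraction is the Ricci tensor. For a gradient this is the Bochner formula.\<close>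

lemma contracted_d_cov:
  assumes p: "p \<in> W" and v: "\<And>k. smooth (v k)"
  shows "contracted_d (cov v) j p = (\<Sum>k\<in>UNIV. (\<Sum>i\<in>UNIV. curv i j p $ i $ k) * v k p)"
proof -
  have pc: "partial c i (cov v j k) p = partial c i (partial c j (v k)) p +
      (\<Sum>a\<in>UNIV. dmat i (\<Gamma> j) p $ k $ a * v a p) + (\<Sum>a\<in>UNIV. \<Gamma> j p $ k $ a * partial c i (v a) p)" for i j k
    unfolding cov_def using p v smooth_\<Gamma> by (simp add: dmat_def sum.distrib)
  have gg: "(\<Sum>a\<in>UNIV. (\<Gamma> i p ** \<Gamma> j p) $ k $ a * v a p) =
      (\<Sum>a\<in>UNIV. \<Gamma> i p $ k $ a * (\<Sum>b\<in>UNIV. \<Gamma> j p $ a $ b * v b p))" for i j k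
    unfolding matrix_matrix_mult_def sum_distrib_left sum_distrib_right vec_lambda_beta
    by (subst sum.swap) (simp add: mult.assoc)
  have "(partial c i (cov v j k) p + (\<Sum>a\<in>UNIV. \<Gamma> i p $ k $ a * cov v j a p)) -
      (partial c j (cov v i k) p + (\<Sum>a\<in>UNIV. \<Gamma> j p $ k $ a * cov v i a p)) =
      (\<Sum>a\<in>UNIV. curv i j p $ k $ a * v a p)" for i k
    unfolding pc curv_def
    using partial_commute[OF p v, of i j k] gg[of i j k] gg[of j i k]
    by (simp add: cov_def algebra_simps sum.distrib sum_subtractf)
  then have "contracted_d (cov v) j p = (\<Sum>i\<in>UNIV. \<Sum>a\<in>UNIV. curv i j p $ i $ a * v a p)"
    by (simp add: contracted_d_def)
  also have "\<dots> = (\<Sum>k\<in>UNIV. (\<Sum>i\<in>UNIV. curv i j p $ i $ k) * v k p)"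
    by (subst sum.swap) (simp add: sum_distrib_right)
  finally show ?thesis .
qed

lemma contracted_d_mult:
  assumes p: "p \<in> W" and a: "smooth a" and X: "\<And>j k. smooth (X j k)"
  shows "contracted_d (\<lambda>j k p. a p * X j k p) j p =
    (\<Sum>i\<in>UNIV. partial c i a p * X j i p) - partial c j a p * (\<Sum>i\<in>UNIV. X i i p) + a p * contracted_d X j p"
  unfolding contracted_d_def using assms
  by (simp add: sum.distrib sum_subtractf sum_distrib_left sum_distrib_right algebra_simps)

lemma contracted_d_add:
  assumes p: "p \<in> W" and X: "\<And>j k. smooth (X j k)" and Y: "\<And>j k. smooth (Y j k)"
  shows "contracted_d (\<lambda>j k p. X j k p + Y j k p) j p = contracted_d X j p + contracted_d Y j p"
  unfolding contracted_d_def using assms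
  by (simp add: sum.distrib sum_subtractf algebra_simps)

text \<open>By torsion-freeness the identity has vanishing exterior covariant derivative. Only the
  Leibniz terms survive: 1 from the divergence, n from the trace.\<close>

lemma contracted_d_identity:
  assumes p: "p \<in> W" and s: "smooth s"
  shows "contracted_d (\<lambda>j k p. s p * (if j = k then 1 else 0)) j p = (1 - real CARD('n)) * partial c j s p"
proof -
  have "contracted_d (\<lambda>j k p. s p * (if j = k then 1 else 0)) j p = (\<Sum>i\<in>UNIV. partial c i s p * (if j = i then 1 else 0)) -
      partial c j s p * (\<Sum>i\<in>(UNIV::'n set). 1) + s p * contracted_d (\<lambda>j k p. if j = k then 1 else 0) j p"
    using contracted_d_mult[OF p s, of "\<lambda>j k p. if j = k then 1 else 0" j] by simp
  also have "contracted_d (\<lambda>j k p. if j = k then 1 else 0) j p = 0"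
    unfolding contracted_d_def using torsion[OF p, of j] by (simp add: sum.delta if_distrib cong: if_cong)
  finally show ?thesis by (simp add: algebra_simps if_distrib sum.delta cong: if_cong)
qed

lemma contracted_d_cong:
  assumes p: "p \<in> W" and X: "\<And>j k q. q \<in> W \<Longrightarrow> X j k q = Y j k q"
  shows "contracted_d X j p = contracted_d Y j p"
proof -
  have "partial c i (X j k) p = partial c i (Y j k) p" for i j k
    using X by (intro partial_cong[OF p])
  then show ?thesis using X[OF p] by (simp add: contracted_d_def)
qed

end

section \<open>The Ricci-Hessian equation in a chart\<close>

context chart_connection
begin

definition grad :: "('a \<Rightarrow> real) \<Rightarrow> 'n \<Rightarrow> 'a \<Rightarrow> real" where
  "grad t k p = (\<Sum>m\<in>UNIV. h p $ k $ m * partial c m t p)"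

definition hess :: "('a \<Rightarrow> real) \<Rightarrow> 'n \<Rightarrow> 'n \<Rightarrow> 'a \<Rightarrow> real" where
  "hess t i j p = partial c i (partial c j t) p - (\<Sum>k\<in>UNIV. \<Gamma> i p $ k $ j * partial c k t p)"

lemma smooth_grad: "smooth t \<Longrightarrow> smooth (grad t k)"
  unfolding grad_def using smooth_h by simp

lemma hess_sym: "p \<in> W \<Longrightarrow> smooth t \<Longrightarrow> hess t i j p = hess t j i p"
  unfolding hess_def using partial_commute[of p t i j] torsion[of p i _ j] by simp

lemma h_sym': "p \<in> W \<Longrightarrow> h p $ k $ m = h p $ m $ k"
  using h_sym[of p] by (metis transpose_def vec_lambda_beta)

text \<open>Raising an index commutes with covariant differentiation because \<open>h\<close> is
  parallel; \<open>dh'\<close> is that property in components.\<close>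

lemma cov_grad:
  assumes p: "p \<in> W" and t: "smooth t"
  shows "cov (grad t) j k p = (\<Sum>m\<in>UNIV. hess t j m p * h p $ m $ k)"
proof -
  have dh': "partial c j (\<lambda>p. h p $ k $ m) p = - (\<Sum>a\<in>UNIV. \<Gamma> j p $ k $ a * h p $ a $ m) - (\<Sum>a\<in>UNIV. h p $ k $ a * \<Gamma> j p $ m $ a)" for m
    using arg_cong[OF dh[OF p, of j], of "\<lambda>M. M $ k $ m"]
    by (simp add: dmat_def matrix_matrix_mult_def transpose_def)
  have 1: "(\<Sum>m\<in>UNIV. (\<Sum>a\<in>UNIV. \<Gamma> j p $ k $ a * h p $ a $ m) * partial c m t p) = (\<Sum>a\<in>UNIV. \<Gamma> j p $ k $ a * grad t a p)"
    unfolding grad_def sum_distrib_left sum_distrib_right by (subst sum.swap) (simp add: mult.assoc)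
  have 2: "(\<Sum>m\<in>UNIV. (\<Sum>a\<in>UNIV. h p $ k $ a * \<Gamma> j p $ m $ a) * partial c m t p) =
      (\<Sum>a\<in>UNIV. h p $ k $ a * (\<Sum>m\<in>UNIV. \<Gamma> j p $ m $ a * partial c m t p))"
    unfolding sum_distrib_left sum_distrib_right by (subst sum.swap) (simp add: mult.assoc)
  have "partial c j (grad t k) p = (\<Sum>m\<in>UNIV. partial c j (\<lambda>p. h p $ k $ m) p * partial c m t p) +
      (\<Sum>m\<in>UNIV. h p $ k $ m * partial c j (partial c m t) p)"
    unfolding grad_def using p t smooth_h by (simp add: sum.distrib)
  also have "(\<Sum>m\<in>UNIV. partial c j (\<lambda>p. h p $ k $ m) p * partial c m t p) =
      - (\<Sum>a\<in>UNIV. \<Gamma> j p $ k $ a * grad t a p) - (\<Sum>a\<in>UNIV. h p $ k $ a * (\<Sum>m\<in>UNIV. \<Gamma> j p $ m $ a * partial c m t p))"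
    unfolding dh' 1[symmetric] 2[symmetric] by (simp add: left_diff_distrib sum_subtractf sum_negf)
  finally have "cov (grad t) j k p = (\<Sum>m\<in>UNIV. h p $ k $ m * hess t j m p)"
    by (simp add: cov_def hess_def right_diff_distrib sum_subtractf)
  then show ?thesis by (simp add: h_sym'[OF p, of k] mult.commute)
qed

text \<open>The Christoffel terms of the covector dt and of its gradient cancel in their pairing;
  the two remaining terms agree by \<open>cov_grad\<close>.\<close>

lemma partial_grad_norm:
  assumes p: "p \<in> W" and t: "smooth t"
  shows "partial c j (\<lambda>p. \<Sum>k\<in>UNIV. partial c k t p * grad t k p) p = 2 * (\<Sum>k\<in>UNIV. hess t j k p * grad t k p)"
proof -
  have "partial c j (\<lambda>p. \<Sum>k\<in>UNIV. partial c k t p * grad t k p) p =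
      (\<Sum>k\<in>UNIV. partial c j (partial c k t) p * grad t k p) +
      (\<Sum>k\<in>UNIV. partial c k t p * (cov (grad t) j k p - (\<Sum>a\<in>UNIV. \<Gamma> j p $ k $ a * grad t a p)))"
    using p t smooth_grad by (simp add: cov_def sum.distrib)
  also have "\<dots> = (\<Sum>k\<in>UNIV. hess t j k p * grad t k p) + (\<Sum>k\<in>UNIV. partial c k t p * cov (grad t) j k p)"
  proof -
    have "(\<Sum>k\<in>UNIV. partial c k t p * (\<Sum>a\<in>UNIV. \<Gamma> j p $ k $ a * grad t a p)) =
        (\<Sum>a\<in>UNIV. (\<Sum>k\<in>UNIV. \<Gamma> j p $ k $ a * partial c k t p) * grad t a p)"
      unfolding sum_distrib_left sum_distrib_right by (subst sum.swap) (simp add: mult_ac)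
    then show ?thesis
      by (simp add: hess_def left_diff_distrib right_diff_distrib sum_subtractf)
  qed
  also have "(\<Sum>k\<in>UNIV. partial c k t p * cov (grad t) j k p) = (\<Sum>m\<in>UNIV. hess t j m p * grad t m p)"
    unfolding cov_grad[OF p t] grad_def sum_distrib_left by (subst sum.swap) (simp add: mult_ac)
  finally show ?thesis by simp
qed

end

text \<open>The hypotheses of the theorem in a single chart. Ricci tensor and Laplacian appear as
  the traces of \<open>curv\<close> and of \<open>cov (grad t)\<close>, in the form that
  \<open>contracted_d\<close> produces.\<close>

locale chart_ricci_hessian = chart_connection c W h \<Gamma>
  for c :: "('a, 'n::finite) chart" and W h \<Gamma> +
  fixes g :: "'a \<Rightarrow> real ^ 'n ^ 'n" and t \<alpha> \<sigma> :: "'a \<Rightarrow> real" and f :: "real \<Rightarrow> real" and J :: "real set"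
  assumes smooth_t: "smooth t" and J: "open J" "smooth_on J f" "t ` W \<subseteq> J"
    and \<alpha>: "p \<in> W \<Longrightarrow> \<alpha> p = f (t p)"
    and g_sym: "p \<in> W \<Longrightarrow> transpose (g p) = g p" and gh: "p \<in> W \<Longrightarrow> g p ** h p = mat 1"
    and equation: "p \<in> W \<Longrightarrow> \<alpha> p * hess t j k p + (\<Sum>i\<in>UNIV. curv i j p $ i $ k) = \<sigma> p * g p $ j $ k"
    and ricci_grad: "p \<in> W \<Longrightarrow> 2 * (\<Sum>k\<in>UNIV. grad t k p * (\<Sum>i\<in>UNIV. curv i k p $ i $ j)) =
      - partial c j (\<lambda>p. \<Sum>i\<in>UNIV. cov (grad t) i i p) p"
begin

definition Qc :: "'a \<Rightarrow> real" where "Qc p = (\<Sum>k\<in>UNIV. partial c k t p * grad t k p)"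
definition Yc :: "'a \<Rightarrow> real" where "Yc p = (\<Sum>i\<in>UNIV. cov (grad t) i i p)"

lemma smooth_Qc: "smooth Qc"
  unfolding Qc_def using smooth_grad smooth_t by simp

lemma smooth_cov_grad: "smooth (cov (grad t) j k)"
  using smooth_cov smooth_grad smooth_t by blast

lemma smooth_Yc: "smooth Yc"
  unfolding Yc_def using smooth_cov_grad by simp

lemma smooth_\<alpha>: "smooth \<alpha>"
  by (rule smooth_cong[OF smooth_compose[OF smooth_t J(2,3)]]) (simp add: \<alpha>)

lemma differentiable_f: "p \<in> W \<Longrightarrow> f differentiable (at (t p))" "p \<in> W \<Longrightarrow> deriv f differentiable (at (t p))"
  using J smooth_on_differentiable smooth_on_deriv by blast+

lemma partial_\<alpha>: "p \<in> W \<Longrightarrow> partial c i \<alpha> p = deriv f (t p) * partial c i t p"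
  using partial_cong[of p \<alpha> "\<lambda>p. f (t p)" i] \<alpha> partial_compose[OF _ smooth_t differentiable_f(1)] by auto

text \<open>Read off from the equation, whose other two terms are symmetric; this replaces the usual
  route through the first Bianchi identity.\<close>

lemma ricci_sym:
  assumes p: "p \<in> W"
  shows "(\<Sum>i\<in>UNIV. curv i j p $ i $ k) = (\<Sum>i\<in>UNIV. curv i k p $ i $ j)"
proof -
  have "g p $ j $ k = g p $ k $ j"
    using g_sym[OF p] by (metis transpose_def vec_lambda_beta)
  then show ?thesis
    using equation[OF p, of j k] equation[OF p, of k j] hess_sym[OF p smooth_t, of j k] by simp
qed

lemma equation_up:
  assumes p: "p \<in> W"
  shows "\<alpha> p * cov (grad t) j k p + ric_up j k p = \<sigma> p * (if j = k then 1 else 0)"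
proof -
  have "\<alpha> p * cov (grad t) j k p + ric_up j k p =
      (\<Sum>m\<in>UNIV. (\<alpha> p * hess t j m p + (\<Sum>i\<in>UNIV. curv i j p $ i $ m)) * h p $ m $ k)"
  proof -
    have "ric_up j k p = (\<Sum>m\<in>UNIV. (\<Sum>i\<in>UNIV. curv i j p $ i $ m) * h p $ m $ k)"
      unfolding ric_up_def curv_up_def matrix_matrix_mult_def sum_distrib_right vec_lambda_beta
      by (rule sum.swap)
    then show ?thesis
      by (simp add: cov_grad[OF p smooth_t] sum_distrib_left sum.distrib distrib_right mult.assoc)
  qed
  also have "\<dots> = \<sigma> p * (\<Sum>m\<in>UNIV. g p $ j $ m * h p $ m $ k)"
    unfolding equation[OF p] by (simp add: sum_distrib_left mult.assoc)
  also have "(\<Sum>m\<in>UNIV. g p $ j $ m * h p $ m $ k) = (if j = k then 1 else 0)"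
    using arg_cong[OF gh[OF p], of "\<lambda>M. M $ j $ k"] by (simp add: matrix_matrix_mult_def mat_def)
  finally show ?thesis .
qed

lemma trace_equation:
  assumes p: "p \<in> W"
  shows "\<alpha> p * Yc p + (\<Sum>i\<in>UNIV. ric_up i i p) = real CARD('n) * \<sigma> p"
proof -
  have "\<alpha> p * Yc p + (\<Sum>i\<in>UNIV. ric_up i i p) = (\<Sum>i\<in>UNIV. \<alpha> p * cov (grad t) i i p + ric_up i i p)"
    by (simp add: Yc_def sum.distrib sum_distrib_left)
  then show ?thesis unfolding equation_up[OF p] by simp
qed

text \<open>Smoothness of \<sigma> is not among the hypotheses; the trace of the equation expresses
  it by smooth functions.\<close>

lemma smooth_\<sigma>: "smooth \<sigma>"
proof (rule smooth_cong)
  show "smooth (\<lambda>p. inverse (real CARD('n)) * (\<alpha> p * Yc p + (\<Sum>i\<in>UNIV. ric_up i i p)))"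
    using smooth_\<alpha> smooth_Yc smooth_ric_up by simp
  show "inverse (real CARD('n)) * (\<alpha> p * Yc p + (\<Sum>i\<in>UNIV. ric_up i i p)) = \<sigma> p" if "p \<in> W" for p
    unfolding trace_equation[OF that] by simp
qed

lemma gradient_identity:
  assumes p: "p \<in> W"
  shows "\<alpha> p * partial c j Qc p - partial c j Yc p = 2 * \<sigma> p * partial c j t p"
proof -
  have dQ: "partial c j Qc p = 2 * (\<Sum>k\<in>UNIV. hess t j k p * grad t k p)"
    using partial_grad_norm[OF p smooth_t] by (simp add: Qc_def[abs_def])
  have dY: "partial c j Yc p = - 2 * (\<Sum>k\<in>UNIV. (\<Sum>i\<in>UNIV. curv i j p $ i $ k) * grad t k p)"
    using ricci_grad[OF p, of j] ricci_sym[OF p, of j] by (simp add: Yc_def[abs_def] mult.commute)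
  have "(\<Sum>k\<in>UNIV. (\<alpha> p * hess t j k p + (\<Sum>i\<in>UNIV. curv i j p $ i $ k)) * grad t k p) =
      \<sigma> p * (\<Sum>k\<in>UNIV. g p $ j $ k * grad t k p)"
    unfolding equation[OF p] by (simp add: sum_distrib_left mult.assoc)
  also have "(\<Sum>k\<in>UNIV. g p $ j $ k * grad t k p) = (\<Sum>m\<in>UNIV. (g p ** h p) $ j $ m * partial c m t p)"
    unfolding grad_def matrix_matrix_mult_def vec_lambda_beta sum_distrib_left sum_distrib_right
    by (subst sum.swap) (simp add: mult.assoc)
  also have "\<dots> = partial c j t p"
    unfolding gh[OF p] by (simp add: mat_def if_distrib[of "\<lambda>x. x * _"] cong: if_cong)
  finally have "(\<Sum>k\<in>UNIV. (\<alpha> p * hess t j k p + (\<Sum>i\<in>UNIV. curv i j p $ i $ k)) * grad t k p) = \<sigma> p * partial c j t p" .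
  then have "\<alpha> p * (\<Sum>k\<in>UNIV. hess t j k p * grad t k p) +
      (\<Sum>k\<in>UNIV. (\<Sum>i\<in>UNIV. curv i j p $ i $ k) * grad t k p) = \<sigma> p * partial c j t p"
    by (simp add: distrib_right sum.distrib sum_distrib_left mult.assoc)
  then show ?thesis
    unfolding dQ dY by (simp add: algebra_simps)
qed

text \<open>\<open>contracted_d\<close> is applied to \<open>equation_up\<close> and doubled. By 3,
  1 and 2 the Hessian term gives \<alpha>' dQ - 2 \<alpha>' Y d\<tau> - \<alpha> dY; by 5 and 4 the
  Ricci term gives \<alpha>' Y d\<tau> + \<alpha> dY - n d\<sigma>; the right side is 2(1 - n)
  d\<sigma>.\<close>

lemma divergence_identity:
  assumes p: "p \<in> W"
  shows "deriv f (t p) * partial c j Qc p + (real CARD('n) - 2) * partial c j \<sigma> p =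
    deriv f (t p) * Yc p * partial c j t p"
proof -
  let ?S = "cov (grad t)"
  let ?s = "\<lambda>p. \<Sum>i\<in>UNIV. ric_up i i p"
  have "contracted_d (\<lambda>j k p. \<alpha> p * ?S j k p + ric_up j k p) j p =
      contracted_d (\<lambda>j k p. \<sigma> p * (if j = k then 1 else 0)) j p"
    by (rule contracted_d_cong[OF p]) (rule equation_up)
  then have eq: "contracted_d (\<lambda>j k p. \<alpha> p * ?S j k p) j p + contracted_d ric_up j p =
      (1 - real CARD('n)) * partial c j \<sigma> p"
    using contracted_d_add[OF p, of "\<lambda>j k p. \<alpha> p * ?S j k p" ric_up] contracted_d_identity[OF p smooth_\<sigma>]
      smooth_\<alpha> smooth_cov_grad smooth_ric_up by simp
  have "contracted_d ?S j p = (\<Sum>k\<in>UNIV. grad t k p * (\<Sum>i\<in>UNIV. curv i k p $ i $ j))"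
    using contracted_d_cov[OF p smooth_grad[OF smooth_t]] ricci_sym[OF p, of j] by (simp add: mult.commute)
  then have 1: "2 * contracted_d ?S j p = - partial c j Yc p"
    using ricci_grad[OF p] by (simp add: Yc_def[abs_def])
  have 2: "2 * (\<Sum>i\<in>UNIV. partial c i t p * ?S j i p) = partial c j Qc p"
  proof -
    have "(\<Sum>i\<in>UNIV. partial c i t p * ?S j i p) = (\<Sum>m\<in>UNIV. hess t j m p * grad t m p)"
      unfolding cov_grad[OF p smooth_t] grad_def sum_distrib_left by (subst sum.swap) (simp add: mult_ac)
    then show ?thesis
      using partial_grad_norm[OF p smooth_t] by (simp add: Qc_def[abs_def])
  qed
  have 3: "contracted_d (\<lambda>j k p. \<alpha> p * ?S j k p) j p =
      deriv f (t p) * (\<Sum>i\<in>UNIV. partial c i t p * ?S j i p) - deriv f (t p) * partial c j t p * Yc p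
      + \<alpha> p * contracted_d ?S j p"
    using contracted_d_mult[OF p smooth_\<alpha> smooth_cov_grad] p
    by (simp add: partial_\<alpha> Yc_def sum_distrib_left mult.assoc)
  have "partial c j (\<lambda>p. real CARD('n) * \<sigma> p) p = partial c j (\<lambda>p. \<alpha> p * Yc p + ?s p) p"
    by (rule partial_cong[OF p]) (simp only: trace_equation)
  then have 4: "partial c j ?s p = real CARD('n) * partial c j \<sigma> p
      - (deriv f (t p) * partial c j t p * Yc p + \<alpha> p * partial c j Yc p)"
    using p smooth_\<sigma> smooth_\<alpha> smooth_Yc smooth_ric_up by (simp add: partial_\<alpha>)
  have 5: "2 * contracted_d ric_up j p = - partial c j ?s p"
    by (rule contracted_bianchi[OF p])
  have "2 * (contracted_d (\<lambda>j k p. \<alpha> p * ?S j k p) j p) + 2 * contracted_d ric_up j p =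
      2 * ((1 - real CARD('n)) * partial c j \<sigma> p)"
    using eq by simp
  moreover have "2 * contracted_d (\<lambda>j k p. \<alpha> p * ?S j k p) j p =
      deriv f (t p) * partial c j Qc p - 2 * (deriv f (t p) * partial c j t p * Yc p) - \<alpha> p * partial c j Yc p"
    unfolding 3 2[symmetric] using arg_cong[OF 1, of "\<lambda>x. \<alpha> p * x"] by (simp add: algebra_simps)
  ultimately show ?thesis
    unfolding 5 4 by (simp add: algebra_simps)
qed

lemma wedge_Y:
  assumes p: "p \<in> W"
  shows "partial c i t p * partial c j Yc p - partial c j t p * partial c i Yc p =
    \<alpha> p * (partial c i t p * partial c j Qc p - partial c j t p * partial c i Qc p)"
proof -
  have dY: "partial c j Yc p = \<alpha> p * partial c j Qc p - 2 * \<sigma> p * partial c j t p" for j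
    using gradient_identity[OF p, of j] by simp
  show ?thesis unfolding dY by (simp add: algebra_simps)
qed

lemma wedge_Q:
  assumes p: "p \<in> W"
  shows "(deriv (deriv f) (t p) + \<alpha> p * deriv f (t p)) *
    (partial c i t p * partial c j Qc p - partial c j t p * partial c i Qc p) = 0"
proof -
  let ?F = "\<lambda>p. deriv f (t p)"
  let ?N = "real CARD('n) - 2"
  have F: "smooth ?F"
    using smooth_compose[OF smooth_t smooth_on_deriv[OF J(1,2)] J(3)] .
  have dF: "partial c i ?F p = deriv (deriv f) (t p) * partial c i t p" for i
    by (rule partial_compose[OF p smooth_t differentiable_f(2)[OF p]])
  have "partial c i (\<lambda>p. ?F p * partial c j Qc p + ?N * partial c j \<sigma> p) p =
      partial c i (\<lambda>p. ?F p * Yc p * partial c j t p) p" for i j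
    by (rule partial_cong[OF p]) (rule divergence_identity)
  then have E: "partial c i ?F p * partial c j Qc p + ?F p * partial c i (partial c j Qc) p + ?N * partial c i (partial c j \<sigma>) p =
      (partial c i ?F p * Yc p + ?F p * partial c i Yc p) * partial c j t p + ?F p * Yc p * partial c i (partial c j t) p" for i j
    using p F smooth_Qc smooth_\<sigma> smooth_Yc smooth_t by simp
  \<comment> \<open>The difference of \<open>E i j\<close> and \<open>E j i\<close>: symmetric
    second derivatives of \<open>Qc\<close>, \<sigma> and \<open>t\<close> drop out, and so does the
    term with \<open>Yc\<close> undifferentiated, because the differential of \<open>?F\<close> is a
    multiple of that of \<open>t\<close>.\<close>
  have "deriv (deriv f) (t p) * (partial c i t p * partial c j Qc p - partial c j t p * partial c i Qc p) =
      - ?F p * (partial c i t p * partial c j Yc p - partial c j t p * partial c i Yc p)"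
    using E[of i j] E[of j i] unfolding dF
      partial_commute[OF p smooth_Qc, of i j] partial_commute[OF p smooth_\<sigma>, of i j] partial_commute[OF p smooth_t, of i j]
    by (simp add: algebra_simps)
  then show ?thesis
    unfolding wedge_Y[OF p] by (simp add: algebra_simps)
qed

end

section \<open>Changes of charts\<close>

lemma chart_region_of_openin:
  fixes c :: "('a, 'n::finite) chart"
  assumes c: "is_chart X c" and W: "openin X W" "W \<subseteq> dom_of c"
  shows "chart_region c W"
proof
  have U: "openin X (dom_of c)" "open (map_of_chart c ` dom_of c)"
    and hom: "homeomorphic_map (subtopology X (dom_of c)) (top_of_set (map_of_chart c ` dom_of c)) (map_of_chart c)"
    using c by (auto simp: is_chart_def)
  show "inj_on (map_of_chart c) (dom_of c)"
    using homeomorphic_imp_injective_map[OF hom] openin_subset[OF U(1)] by (simp add: Int_absorb1)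
  have "openin (subtopology X (dom_of c)) W"
    using W U openin_open_subtopology by blast
  then have "openin (top_of_set (map_of_chart c ` dom_of c)) (map_of_chart c ` W)"
    using homeomorphic_imp_open_map[OF hom] by (simp add: open_map_def)
  then show "open (map_of_chart c ` W)" using U(2) openin_open_trans by blast
qed (use W in simp)

lemma openin_chart_vimage:
  fixes c :: "('a, 'n::finite) chart"
  assumes c: "is_chart X c" and V: "open V"
  shows "openin X {q \<in> dom_of c. map_of_chart c q \<in> V}"
proof -
  have U: "openin X (dom_of c)"
    and hom: "homeomorphic_map (subtopology X (dom_of c)) (top_of_set (map_of_chart c ` dom_of c)) (map_of_chart c)"
    using c by (auto simp: is_chart_def)
  have "continuous_map (subtopology X (dom_of c)) euclidean (map_of_chart c)"
    using homeomorphic_imp_continuous_map[OF hom] continuous_map_in_subtopology by blast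
  then have "openin (subtopology X (dom_of c)) {q \<in> topspace (subtopology X (dom_of c)). map_of_chart c q \<in> V}"
    by (rule openin_continuous_map_preimage) (use V open_openin in blast)
  then show ?thesis
    using openin_subset[OF U] openin_open_subtopology[OF U] by (simp add: Int_absorb1)
qed

lemma dirderiv_expand_axis:
  fixes f :: "real ^ 'n \<Rightarrow> real"
  assumes "f differentiable (at x)"
  shows "dirderiv f v x = (\<Sum>a\<in>UNIV. v $ a * dirderiv f (axis a 1) x)"
proof -
  have "(\<Sum>b\<in>Basis. (v \<bullet> b) * dirderiv f b x) = (\<Sum>a\<in>UNIV. (v \<bullet> axis a 1) * dirderiv f (axis a 1) x)"
  proof -
    have "Basis = range (\<lambda>a. axis a 1 :: real ^ 'n)" by (auto simp: Basis_vec_def)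
    moreover have "inj (\<lambda>a. axis a 1 :: real ^ 'n)" by (auto simp: inj_on_def axis_eq_axis)
    ultimately show ?thesis
      using sum.reindex[of "\<lambda>a. axis a 1" UNIV "\<lambda>b. (v \<bullet> b) * dirderiv f b x"] by (simp only: o_def)
  qed
  then show ?thesis
    unfolding dirderiv_expand[OF assms, of v] by (simp only: inner_axis inner_real_def mult_1_right)
qed

locale chart_overlap = chart_region c W + C': chart_region c' W
  for c c' :: "('a, 'n::finite) chart" and W +
  assumes smooth_transition: "smooth_in_chart c W (map_of_chart c')"
begin

lemma smooth_change:
  assumes "smooth_in_chart c' W f"
  shows "smooth f"
proof -
  have "smooth_on (map_of_chart c ` W) (\<lambda>x. C'.rep f (rep (map_of_chart c') x))"
    using assms smooth_transition inv_chart
    by (intro smooth_on_compose[OF open_image, where J="map_of_chart c' ` W"]) (auto simp: smooth_in_chart_def o_def)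
  then show ?thesis
    unfolding smooth_iff by (rule smooth_on_cong[OF open_image, rotated]) (auto simp: inv_chart C'.inv_chart)
qed

lemma smooth_coordinate: "smooth (\<lambda>q. map_of_chart c' q $ a)"
  using smooth_on_bounded_linear_compose[OF bounded_linear_vec_nth open_image] smooth_transition
  by (auto simp: smooth_in_chart_def o_def)

lemma smooth_jacobian: "smooth (\<lambda>q. jacobian c c' q $ a $ i)"
  unfolding jacobian_def using smooth_coordinate by simp

lemma partial_change:
  assumes p: "p \<in> W" and f: "smooth_in_chart c' W f"
  shows "partial c i f p = (\<Sum>a\<in>UNIV. jacobian c c' p $ a $ i * partial c' a f p)"
proof -
  let ?x = "map_of_chart c p"
  define T where "T = rep (map_of_chart c')"
  have Tx: "T ?x = map_of_chart c' p" using inv_chart[OF p] by (simp add: T_def)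
  have T: "T differentiable (at ?x)"
    using smooth_transition p smooth_on_differentiable by (auto simp: smooth_in_chart_def T_def)
  then have dT: "(T has_derivative (\<lambda>v. dirderiv T v ?x)) (at ?x)" by (rule has_derivative_dirderiv)
  have df: "C'.rep f differentiable (at (T ?x))" unfolding Tx using f p by (rule C'.rep_differentiable)
  have jac: "dirderiv T (axis i 1) ?x $ a = jacobian c c' p $ a $ i" for a
  proof -
    have "((\<lambda>x. T x $ a) has_derivative (\<lambda>v. dirderiv T v ?x $ a)) (at ?x)"
      using bounded_linear.has_derivative[OF bounded_linear_vec_nth dT] .
    from dirderiv_eqI[OF this] show ?thesis by (simp add: jacobian_def partial_def T_def o_def)
  qed
  have "partial c i f p = dirderiv (\<lambda>x. C'.rep f (T x)) (axis i 1) ?x"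
    unfolding partial_def by (rule dirderiv_cong[OF open_image]) (use p in \<open>auto simp: T_def inv_chart C'.inv_chart\<close>)
  also have "\<dots> = dirderiv (C'.rep f) (dirderiv T (axis i 1) ?x) (T ?x)"
    using dirderiv_eqI[OF has_derivative_compose[OF dT has_derivative_dirderiv[OF df]]] .
  also have "\<dots> = (\<Sum>a\<in>UNIV. dirderiv T (axis i 1) ?x $ a * dirderiv (C'.rep f) (axis a 1) (T ?x))"
    by (rule dirderiv_expand_axis[OF df])
  finally show ?thesis unfolding Tx jac by (simp add: partial_def[of c'])
qed

lemma differential_change:
  assumes "p \<in> W" "smooth_in_chart c' W f"
  shows "differential f c p = transpose (jacobian c c' p) *v differential f c' p"
  using partial_change[OF assms]
  by (simp add: differential_def vec_eq_iff matrix_vector_mult_def transpose_def)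

text \<open>The second derivatives of the transition map, produced by differentiating the chain
  rule, are exactly the inhomogeneous term in the transformation law of the connection.\<close>

lemma hessian_change:
  assumes p: "p \<in> W" and t: "smooth_in_chart c' W t"
    and conn: "\<forall>l i j. (\<Sum>k\<in>UNIV. jacobian c c' p $ l $ k * \<Gamma> c p $ k $ i $ j) =
        partial c i (\<lambda>q. jacobian c c' q $ l $ j) p +
        (\<Sum>a\<in>UNIV. \<Sum>b\<in>UNIV. jacobian c c' p $ a $ i * jacobian c c' p $ b $ j * \<Gamma> c' p $ l $ a $ b)"
  shows "hessian \<Gamma> t c p = transpose (jacobian c c' p) ** hessian \<Gamma> t c' p ** jacobian c c' p"
proof -
  let ?J = "jacobian c c' p"
  have "hessian \<Gamma> t c p $ i $ j = (\<Sum>a\<in>UNIV. \<Sum>b\<in>UNIV. ?J $ a $ i * ?J $ b $ j * hessian \<Gamma> t c' p $ a $ b)" for i j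
  proof -
    have "partial c i (partial c j t) p = partial c i (\<lambda>q. \<Sum>l\<in>UNIV. jacobian c c' q $ l $ j * partial c' l t q) p"
      by (rule partial_cong[OF p]) (rule partial_change[OF _ t])
    also have "\<dots> = (\<Sum>l\<in>UNIV. partial c i (\<lambda>q. jacobian c c' q $ l $ j) p * partial c' l t p) +
        (\<Sum>l\<in>UNIV. ?J $ l $ j * partial c i (partial c' l t) p)"
      using p smooth_jacobian smooth_change[OF C'.smooth_partial[OF t]] by (simp add: sum.distrib)
    also have "(\<Sum>l\<in>UNIV. ?J $ l $ j * partial c i (partial c' l t) p) =
        (\<Sum>a\<in>UNIV. \<Sum>b\<in>UNIV. ?J $ a $ i * ?J $ b $ j * partial c' a (partial c' b t) p)"
      unfolding partial_change[OF p C'.smooth_partial[OF t]] sum_distrib_left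
      by (subst sum.swap) (simp add: mult_ac)
    finally have 1: "partial c i (partial c j t) p = (\<Sum>l\<in>UNIV. partial c i (\<lambda>q. jacobian c c' q $ l $ j) p * partial c' l t p) +
        (\<Sum>a\<in>UNIV. \<Sum>b\<in>UNIV. ?J $ a $ i * ?J $ b $ j * partial c' a (partial c' b t) p)" .
    have "(\<Sum>k\<in>UNIV. \<Gamma> c p $ k $ i $ j * partial c k t p) =
        (\<Sum>l\<in>UNIV. (\<Sum>k\<in>UNIV. ?J $ l $ k * \<Gamma> c p $ k $ i $ j) * partial c' l t p)"
      unfolding partial_change[OF p t] sum_distrib_left sum_distrib_right
      by (subst sum.swap) (simp add: mult_ac)
    also have "\<dots> = (\<Sum>l\<in>UNIV. partial c i (\<lambda>q. jacobian c c' q $ l $ j) p * partial c' l t p) +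
        (\<Sum>l\<in>UNIV. \<Sum>a\<in>UNIV. \<Sum>b\<in>UNIV. ?J $ a $ i * ?J $ b $ j * (\<Gamma> c' p $ l $ a $ b * partial c' l t p))"
      unfolding conn[rule_format] by (simp add: distrib_right sum.distrib sum_distrib_right mult.assoc)
    also have "(\<Sum>l\<in>UNIV. \<Sum>a\<in>UNIV. \<Sum>b\<in>UNIV. ?J $ a $ i * ?J $ b $ j * (\<Gamma> c' p $ l $ a $ b * partial c' l t p)) =
        (\<Sum>a\<in>UNIV. \<Sum>b\<in>UNIV. ?J $ a $ i * ?J $ b $ j * (\<Sum>l\<in>UNIV. \<Gamma> c' p $ l $ a $ b * partial c' l t p))"
      by (subst sum.swap, rule sum.cong[OF refl], subst sum.swap) (simp add: sum_distrib_left)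
    finally show ?thesis
      using 1 by (simp add: hessian_def differential_def right_diff_distrib sum_subtractf)
  qed
  moreover have "(transpose ?J ** hessian \<Gamma> t c' p ** ?J) $ i $ j =
      (\<Sum>a\<in>UNIV. \<Sum>b\<in>UNIV. ?J $ a $ i * ?J $ b $ j * hessian \<Gamma> t c' p $ a $ b)" for i j
    unfolding matrix_matrix_mult_def transpose_def vec_lambda_beta sum_distrib_right
    by (subst sum.swap) (simp add: mult_ac)
  ultimately show ?thesis by (simp add: vec_eq_iff)
qed

end

lemma matrix_left_cancel:
  fixes A B C :: "real ^ 'n ^ 'n"
  assumes "invertible A" "A ** B = A ** C"
  shows "B = C"
  by (metis assms matrix_inv_left matrix_mul_assoc matrix_mul_lid)

text \<open>The transformation law of the inverse metric. That \<open>J\<close> is invertible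
  follows from the determinants of the two metrics, so the reverse change of charts is not
  consulted.\<close>

lemma matrix_inv_congruence:
  fixes G G' J :: "real ^ 'n ^ 'n"
  assumes G: "invertible G" "invertible G'" and GJ: "G = transpose J ** G' ** J"
  shows "J ** matrix_inv G ** transpose J = matrix_inv G'"
proof -
  have "det J \<noteq> 0"
    using G GJ by (auto simp: invertible_det_nz det_mul)
  then have J: "invertible (transpose J)" by (simp add: invertible_det_nz)
  have "transpose J ** (G' ** (J ** matrix_inv G ** transpose J)) = (transpose J ** G' ** J) ** matrix_inv G ** transpose J"
    by (simp add: matrix_mul_assoc)
  also have "\<dots> = transpose J ** mat 1"
    unfolding GJ[symmetric] matrix_inv_right[OF G(1)] by simp
  finally have "G' ** (J ** matrix_inv G ** transpose J) = mat 1"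
    by (rule matrix_left_cancel[OF J])
  then have "G' ** (J ** matrix_inv G ** transpose J) = G' ** matrix_inv G'"
    by (simp add: matrix_inv_right[OF G(2)])
  then show ?thesis by (rule matrix_left_cancel[OF G(2)])
qed

lemma invertible_positive_definite:
  fixes G :: "real ^ 'n ^ 'n"
  assumes "\<And>x. x \<noteq> 0 \<Longrightarrow> x \<bullet> (G *v x) > 0"
  shows "invertible G"
proof -
  have "x = 0" if "G *v x = 0" for x
    using assms[of x] that by force
  then show ?thesis
    using matrix_left_invertible_ker[of G] invertible_left_inverse by blast
qed

section \<open>Local functions of a function\<close>

text \<open>Near \<open>p\<close> both \<open>\<kappa>\<close> and the \<open>i\<close>-th partial
  derivative of \<open>t\<close> stay nonzero, so dividing by them makes the differential of
  \<open>F\<close> a multiple of that of \<open>t\<close>; the \<open>i\<close>-th coordinate axis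
  is the transversal direction.\<close>

lemma (in chart_region) locally_function_of_proportional:
  assumes c: "is_chart X c" and p: "p \<in> W" and t: "smooth t" and F: "smooth F" and \<kappa>: "smooth \<kappa>" "\<kappa> p \<noteq> 0"
    and nz: "partial c i t p \<noteq> 0"
    and wedge: "\<And>q j. q \<in> W \<Longrightarrow> \<kappa> q * (partial c i t q * partial c j F q - partial c j t q * partial c i F q) = 0"
  shows "locally_function_of X p F t"
proof -
  let ?D = "map_of_chart c ` W" and ?e = "axis i 1 :: real ^ 'n"
  define S where "S = ?D \<inter> rep (\<lambda>q. \<kappa> q * partial c i t q) -` (- {0})"
  have "continuous_on ?D (rep (\<lambda>q. \<kappa> q * partial c i t q))"
    using \<kappa> t smooth_mult smooth_partial smooth_on_continuous_on unfolding smooth_iff by blast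
  then have S: "open S"
    unfolding S_def using open_image by (intro continuous_open_preimage) auto
  have SD: "S \<subseteq> ?D" by (auto simp: S_def)
  have x0: "map_of_chart c p \<in> S"
    using p \<kappa> nz inv_chart[OF p] by (auto simp: S_def)
  have smt: "smooth_on S (rep t)" and smF: "smooth_on S (rep F)"
    using t F SD smooth_on_subset unfolding smooth_iff by blast+
  have e: "norm ?e = 1" by simp
  have S_point: "\<exists>q\<in>W. x = map_of_chart c q \<and> \<kappa> q \<noteq> 0 \<and> partial c i t q \<noteq> 0" if "x \<in> S" for x
    using that inv_chart by (auto simp: S_def)
  have nzS: "dirderiv (rep t) ?e x \<noteq> 0" if "x \<in> S" for x
    using S_point[OF that] by (auto simp: partial_def)
  have dep: "dirderiv (rep t) ?e x * dirderiv (rep F) u x = dirderiv (rep t) u x * dirderiv (rep F) ?e x"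
    if x: "x \<in> S" for x u
  proof -
    obtain q where q: "q \<in> W" "x = map_of_chart c q" "\<kappa> q \<noteq> 0" using S_point[OF x] by blast
    have "partial c i t q * partial c j F q = partial c j t q * partial c i F q" for j
      using wedge[OF q(1), of j] q(3) by simp
    then have "dirderiv (rep t) ?e x * dirderiv (rep F) (axis j 1) x = dirderiv (rep t) (axis j 1) x * dirderiv (rep F) ?e x" for j
      by (simp add: partial_def q(2))
    then show ?thesis
      unfolding dirderiv_expand_axis[OF smooth_on_differentiable[OF smt x], of u]
        dirderiv_expand_axis[OF smooth_on_differentiable[OF smF x], of u]
        sum_distrib_left sum_distrib_right
      by (intro sum.cong refl) (simp add: mult.left_commute mult.assoc)
  qed
  obtain V I \<gamma> where V: "open V" "map_of_chart c p \<in> V" "V \<subseteq> S" and I: "open I" "is_interval I" "rep t ` V \<subseteq> I"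
    and \<gamma>: "\<And>s. s \<in> I \<Longrightarrow> \<gamma> s \<in> S"
      "\<And>s. s \<in> I \<Longrightarrow> (\<gamma> has_derivative (\<lambda>r. (r / dirderiv (rep t) ?e (\<gamma> s)) *\<^sub>R ?e)) (at s)"
    and const: "\<And>G x. \<lbrakk>smooth_on S G; \<And>x u. x \<in> S \<Longrightarrow> dirderiv (rep t) ?e x * dirderiv G u x = dirderiv (rep t) u x * dirderiv G ?e x;
      x \<in> V\<rbrakk> \<Longrightarrow> (G x :: real) = G (\<gamma> (rep t x))"
    using transversal_curve[OF S x0 smt e nzS] by blast
  have sm: "smooth_on I (\<lambda>s. rep F (\<gamma> s))"
    by (rule smooth_on_transversal_curve[OF S I(1) smt smF nzS \<gamma>])
  define U where "U = {q \<in> dom_of c. map_of_chart c q \<in> V}"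
  \<comment> \<open>\<open>U\<close> is cut out of the whole chart domain to be open in
    \<open>X\<close>; as \<open>V\<close> lies in the image of \<open>W\<close>, injectivity of the
    chart brings \<open>U\<close> back into \<open>W\<close>.\<close>
  have UW: "q \<in> W" if "q \<in> U" for q
  proof -
    have "map_of_chart c q \<in> ?D" using that V(3) SD unfolding U_def by blast
    then obtain q' where "q' \<in> W" "map_of_chart c q = map_of_chart c q'" by blast
    then show ?thesis using inj W that unfolding U_def inj_on_def by blast
  qed
  have "t q \<in> I \<and> F q = rep F (\<gamma> (t q))" if q: "q \<in> U" for q
  proof -
    have v: "map_of_chart c q \<in> V" using q by (simp add: U_def)
    have "rep t (map_of_chart c q) = t q" "rep F (map_of_chart c q) = F q"
      using inv_chart[OF UW[OF q]] by simp_all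
    then show ?thesis
      using I(3) v const[OF smF dep v] by (metis image_subset_iff)
  qed
  then show ?thesis
    unfolding locally_function_of_def using I sm V(2) p W openin_chart_vimage[OF c V(1)]
    by (intro exI[of _ U] exI[of _ I] exI[of _ "\<lambda>s. rep F (\<gamma> s)"]) (auto simp: U_def)
qed

section \<open>Chart independence of the contractions\<close>

lemma chart_at:
  assumes "c \<in> A" "p \<in> dom_of c"
  shows "chart_at A p \<in> A" "p \<in> dom_of (chart_at A p)"
  using someI[of "\<lambda>c. c \<in> A \<and> p \<in> dom_of c" c] assms by (auto simp: chart_at_def)

lemma chart_overlap:
  fixes A :: "('a, 'n::finite) chart set"
  assumes "smooth_manifold M A" "c \<in> A" "c' \<in> A"
  shows "chart_overlap c c' (dom_of c \<inter> dom_of c')"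
proof -
  have "is_chart M c" "is_chart M c'" and tr: "smooth_in_chart c (dom_of c \<inter> dom_of c') (map_of_chart c')"
    using assms by (auto simp: smooth_manifold_def)
  moreover from this have "openin M (dom_of c \<inter> dom_of c')"
    by (auto simp: is_chart_def)
  ultimately show ?thesis
    by (intro chart_overlap.intro chart_overlap_axioms.intro chart_region_of_openin) auto
qed

lemma riemannian_metric_smooth:
  "riemannian_metric A g \<Longrightarrow> c \<in> A \<Longrightarrow> smooth_in_chart c (dom_of c) (\<lambda>p. g c p $ i $ j)"
  unfolding riemannian_metric_def by blast

lemma riemannian_metric_sym:
  "riemannian_metric A g \<Longrightarrow> c \<in> A \<Longrightarrow> p \<in> dom_of c \<Longrightarrow> transpose (g c p) = g c p"
  unfolding riemannian_metric_def by blast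

lemma affine_connection_smooth:
  "affine_connection A \<Gamma> \<Longrightarrow> c \<in> A \<Longrightarrow> smooth_in_chart c (dom_of c) (\<lambda>p. \<Gamma> c p $ k $ i $ j)"
  unfolding affine_connection_def by blast

lemma metric_invertible:
  assumes "riemannian_metric A g" "c \<in> A" "p \<in> dom_of c"
  shows "invertible (g c p)"
proof (rule invertible_positive_definite)
  show "x \<bullet> (g c p *v x) > 0" if "x \<noteq> 0" for x
    using assms that unfolding riemannian_metric_def by blast
qed

text \<open>\<open>metric_inner\<close> and \<open>metric_trace\<close> use a chart that may jump
  from point to point. Comparing two charts around one point allows both scalars to be computed, and
  then differentiated, in one chart.\<close>

context
  fixes M :: "'a topology" and A :: "('a, 'n::finite) chart set"
    and g :: "('a, 'n) tensor2" and t :: "'a \<Rightarrow> real" and c c' :: "('a, 'n) chart" and p :: 'a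
  assumes manifold: "smooth_manifold M A" and metric: "riemannian_metric A g"
    and t: "smooth_function A t" and cA: "c \<in> A" and c'A: "c' \<in> A" and p: "p \<in> dom_of c" and p': "p \<in> dom_of c'"
begin

interpretation chart_overlap c c' "dom_of c \<inter> dom_of c'"
  by (rule chart_overlap[OF manifold cA c'A])

lemma smooth_t': "smooth_in_chart c' (dom_of c \<inter> dom_of c') t"
proof -
  have "smooth_on (map_of_chart c' ` dom_of c') (C'.rep t)"
    using t c'A by (simp add: smooth_function_def smooth_in_chart_def)
  then show ?thesis
    unfolding smooth_in_chart_def by (rule smooth_on_subset) (simp add: image_mono)
qed

lemma matrix_inv_metric_change:
  "jacobian c c' p ** matrix_inv (g c p) ** transpose (jacobian c c' p) = matrix_inv (g c' p)"
proof (rule matrix_inv_congruence)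
  show "invertible (g c p)" "invertible (g c' p)"
    using metric_invertible[OF metric] cA c'A p p' by simp_all
  show "g c p = transpose (jacobian c c' p) ** g c' p ** jacobian c c' p"
    by (rule metric[unfolded riemannian_metric_def, THEN conjunct2, THEN conjunct2, rule_format,
        OF cA c'A IntI[OF p p']])
qed

lemma gradient_norm_change:
  "(matrix_inv (g c p) *v differential t c p) \<bullet> differential t c p =
   (matrix_inv (g c' p) *v differential t c' p) \<bullet> differential t c' p"
proof -
  let ?J = "jacobian c c' p"
  have d: "differential t c p = transpose ?J *v differential t c' p"
    by (rule differential_change[OF IntI[OF p p'] smooth_t'])
  have "(matrix_inv (g c p) *v differential t c p) \<bullet> (transpose ?J *v differential t c' p) =
      (?J *v (matrix_inv (g c p) *v differential t c p)) \<bullet> differential t c' p"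
    by (metis dot_lmul_matrix inner_commute transpose_matrix_vector)
  also have "?J *v (matrix_inv (g c p) *v differential t c p) = matrix_inv (g c' p) *v differential t c' p"
    unfolding d matrix_vector_mul_assoc matrix_inv_metric_change[symmetric] by (simp add: matrix_mul_assoc)
  finally show ?thesis using d by simp
qed

lemma hessian_trace_change:
  assumes conn: "affine_connection A \<Gamma>"
  shows "trace (matrix_inv (g c p) ** hessian \<Gamma> t c p) = trace (matrix_inv (g c' p) ** hessian \<Gamma> t c' p)"
proof -
  let ?J = "jacobian c c' p"
  note conn_p = bspec[OF bspec[OF bspec[OF conjunct2[OF conn[unfolded affine_connection_def]] cA] c'A] IntI[OF p p']]
  have "hessian \<Gamma> t c p = transpose ?J ** hessian \<Gamma> t c' p ** ?J"
    by (rule hessian_change[of p t \<Gamma>, OF IntI[OF p p'] smooth_t' conn_p])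
  then have "trace (matrix_inv (g c p) ** hessian \<Gamma> t c p) =
      trace ((matrix_inv (g c p) ** transpose ?J ** hessian \<Gamma> t c' p) ** ?J)"
    by (simp add: matrix_mul_assoc)
  also have "\<dots> = trace (?J ** (matrix_inv (g c p) ** transpose ?J ** hessian \<Gamma> t c' p))"
    by (rule trace_mul_sym)
  finally show ?thesis
    by (simp add: matrix_inv_metric_change[symmetric] matrix_mul_assoc)
qed

end

lemma metric_inner_gradient:
  assumes metric: "riemannian_metric A g" and manifold: "smooth_manifold M A" and t: "smooth_function A t"
    and c: "c \<in> A" "p \<in> dom_of c"
  shows "metric_inner A g (gradient g t) (gradient g t) p =
    (matrix_inv (g c p) *v differential t c p) \<bullet> differential t c p"
proof -
  let ?c = "chart_at A p"
  have c': "?c \<in> A" "p \<in> dom_of ?c" using chart_at[OF c] by simp_all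
  have "g ?c p *v (matrix_inv (g ?c p) *v x) = x" for x
    using matrix_inv_right[OF metric_invertible[OF metric c']] by (simp add: matrix_vector_mul_assoc)
  then have "metric_inner A g (gradient g t) (gradient g t) p =
      (matrix_inv (g ?c p) *v differential t ?c p) \<bullet> differential t ?c p"
    by (simp add: metric_inner_def Let_def gradient_def)
  then show ?thesis
    using gradient_norm_change[OF manifold metric t c'(1) c(1) c'(2) c(2)] by simp
qed

lemma laplacian_in_chart:
  assumes metric: "riemannian_metric A g" and manifold: "smooth_manifold M A" and t: "smooth_function A t"
    and c: "c \<in> A" "p \<in> dom_of c" and conn: "affine_connection A \<Gamma>"
  shows "laplacian A g \<Gamma> t p = trace (matrix_inv (g c p) ** hessian \<Gamma> t c p)"
  using hessian_trace_change[OF manifold metric t chart_at(1)[OF c] c(1) chart_at(2)[OF c] c(2) conn]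
  by (simp add: laplacian_def metric_trace_def Let_def)

text \<open>The point is \<open>dh\<close>: metric compatibility concerns \<open>g\<close>, and
  differentiating the identity that \<open>g\<close> times its inverse is 1 transfers it to the
  inverse.\<close>

lemma chart_connection_levi_civita:
  fixes A :: "('a, 'n::finite) chart set"
  assumes manifold: "smooth_manifold M A" and metric: "riemannian_metric A g"
    and lc: "levi_civita_connection A g \<Gamma>" and c: "c \<in> A"
  shows "chart_connection c (dom_of c) (\<lambda>p. matrix_inv (g c p)) (\<lambda>i p. \<chi> k j. \<Gamma> c p $ k $ i $ j)"
proof -
  have "is_chart M c" using manifold c by (simp add: smooth_manifold_def)
  then interpret chart_region c "dom_of c"
    by (intro chart_region_of_openin) (auto simp: is_chart_def)
  let ?h = "\<lambda>p. matrix_inv (g c p)" and ?\<Gamma> = "\<lambda>i p. \<chi> k j. \<Gamma> c p $ k $ i $ j"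
  have inv: "invertible (g c p)" if "p \<in> dom_of c" for p
    by (rule metric_invertible[OF metric c that])
  have sg: "smooth_mat (g c)" using riemannian_metric_smooth[OF metric c] by simp
  have gsym: "transpose (g c p) = g c p" if "p \<in> dom_of c" for p
    by (rule riemannian_metric_sym[OF metric c that])
  have sh: "smooth_mat ?h" using smooth_matrix_inv sg inv by blast
  show ?thesis
  proof
    show "smooth_mat ?h" by (rule sh)
    show "smooth_mat (?\<Gamma> i)" for i
      using affine_connection_smooth[OF _ c] lc by (simp add: levi_civita_connection_def)
    fix p assume p: "p \<in> dom_of c"
    show "?\<Gamma> i p $ k $ j = ?\<Gamma> j p $ k $ i" for i j k
      using lc c p by (simp add: levi_civita_connection_def torsion_free_def)
    have "transpose (?h p) ** g c p = mat 1"
      using arg_cong[OF matrix_inv_right[OF inv[OF p]], of transpose]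
      by (simp add: matrix_transpose_mul gsym[OF p])
    then show "transpose (?h p) = ?h p"
      by (metis matrix_inv_right[OF inv[OF p]] matrix_mul_assoc matrix_mul_lid matrix_mul_rid)
    fix i
    have dg: "dmat i (g c) p = transpose (?\<Gamma> i p) ** g c p + g c p ** ?\<Gamma> i p"
      using lc c p
      by (simp add: levi_civita_connection_def metric_compatible_def dmat_def vec_eq_iff
          matrix_matrix_mult_def transpose_def mult.commute)
    have "dmat i (\<lambda>p. g c p ** ?h p) p = dmat i (\<lambda>_. mat 1) p"
      using matrix_inv_right inv by (intro dmat_cong[OF p]) blast
    also have "\<dots> = 0" by (simp add: dmat_def vec_eq_iff)
    finally have "dmat i (g c) p ** ?h p + g c p ** dmat i ?h p = 0"
      using dmat_mult[OF p sg sh] by simp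
    then have "?h p ** (dmat i (g c) p ** ?h p + g c p ** dmat i ?h p) = 0" by simp
    then have "?h p ** transpose (?\<Gamma> i p) ** (g c p ** ?h p) + (?h p ** g c p) ** ?\<Gamma> i p ** ?h p
        + (?h p ** g c p) ** dmat i ?h p = 0"
      unfolding dg by (simp add: matrix_mult_distribs matrix_mul_assoc)
    then show "dmat i ?h p = - (?\<Gamma> i p ** ?h p) - ?h p ** transpose (?\<Gamma> i p)"
      unfolding matrix_inv_right[OF inv[OF p]] matrix_inv_left[OF inv[OF p]]
      by (simp add: algebra_simps eq_neg_iff_add_eq_0)
  qed
qed

section \<open>The theorem\<close>

theorem theoremA:
  fixes M :: "'a topology"
    and A :: "('a, 'n::finite) chart set"
    and g :: "('a, 'n) tensor2"
    and nabla :: "('a, 'n) conn"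
    and \<tau> \<alpha> \<sigma> Q Y :: "'a \<Rightarrow> real"
    and v :: "('a, 'n) vec_field"
    and f :: "real \<Rightarrow> real" and J :: "real set"
  assumes dim: "CARD('n) > 2"
    and manifold: "smooth_manifold M A"
    and metric: "riemannian_metric A g"
    and levi_civita: "levi_civita_connection A g nabla"
    and tau: "smooth_function A \<tau>"
    and f: "open J" "is_interval J" "\<tau> ` topspace M \<subseteq> J" "smooth_on J f"
    and alpha: "\<forall>p\<in>topspace M. \<alpha> p = f (\<tau> p)"
    and dense: "M closure_of {p. \<exists>c\<in>A. p \<in> dom_of c \<and> \<alpha> p *\<^sub>R hessian nabla \<tau> c p \<noteq> 0} = topspace M"
    and equation: "\<forall>c\<in>A. \<forall>p\<in>dom_of c. \<alpha> p *\<^sub>R hessian nabla \<tau> c p + ricci nabla c p = \<sigma> p *\<^sub>R g c p"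
    and v: "v = gradient g \<tau>"
    and Q: "Q = metric_inner A g (gradient g \<tau>) (gradient g \<tau>)"
    and Y: "Y = laplacian A g nabla \<tau>"
    and ricci_v: "\<forall>c\<in>A. \<forall>p\<in>dom_of c. 2 *\<^sub>R (v c p v* ricci nabla c p) = - differential Y c p"
  shows "\<forall>c\<in>A. \<forall>p\<in>dom_of c.
           deriv (deriv f) (\<tau> p) + \<alpha> p * deriv f (\<tau> p) \<noteq> 0 \<and> differential \<tau> c p \<noteq> 0 \<longrightarrow>
           locally_function_of M p Q \<tau> \<and> locally_function_of M p Y \<tau>"
proof (intro ballI impI, elim conjE)
  fix c p
  assume c: "c \<in> A" and p: "p \<in> dom_of c"
    and nz: "deriv (deriv f) (\<tau> p) + \<alpha> p * deriv f (\<tau> p) \<noteq> 0" "differential \<tau> c p \<noteq> 0"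
  let ?h = "\<lambda>p. matrix_inv (g c p)"
  define \<Gamma> where "\<Gamma> = (\<lambda>i p. \<chi> k j. nabla c p $ k $ i $ j)"
  have \<Gamma>: "\<Gamma> i q $ k $ j = nabla c q $ k $ i $ j" for i q k j by (simp add: \<Gamma>_def)
  have aff: "affine_connection A nabla" using levi_civita by (simp add: levi_civita_connection_def)
  have chart: "is_chart M c" using manifold c by (simp add: smooth_manifold_def)
  then have sub: "dom_of c \<subseteq> topspace M" by (auto simp: is_chart_def dest: openin_subset)
  interpret chart_connection c "dom_of c" ?h \<Gamma>
    unfolding \<Gamma>_def by (rule chart_connection_levi_civita[OF manifold metric levi_civita c])
  have hess: "hessian nabla \<tau> c q $ i $ j = hess \<tau> i j q" for q i j
    by (simp add: hessian_def hess_def differential_def \<Gamma>)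
  have ric: "ricci nabla c q $ j $ k = (\<Sum>i\<in>UNIV. curv i j q $ i $ k)" for q j k
    by (simp add: ricci_def curvature_def curv_def dmat_def matrix_matrix_mult_def sum_subtractf \<Gamma>)
  have st: "smooth \<tau>" using tau c by (simp add: smooth_function_def)
  have Yc: "Y q = (\<Sum>i\<in>UNIV. cov (grad \<tau>) i i q)" if "q \<in> dom_of c" for q
  proof -
    have "Y q = (\<Sum>i\<in>UNIV. \<Sum>m\<in>UNIV. ?h q $ i $ m * hess \<tau> m i q)"
      unfolding Y laplacian_in_chart[OF metric manifold tau c that aff]
      by (simp add: trace_def matrix_matrix_mult_def hess)
    then show ?thesis
      by (simp add: cov_grad[OF that st] h_sym'[OF that] hess_sym[OF that st] mult.commute)
  qed
  have Qc: "Q q = (\<Sum>k\<in>UNIV. partial c k \<tau> q * grad \<tau> k q)" if "q \<in> dom_of c" for q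
    unfolding Q metric_inner_gradient[OF metric manifold tau c that]
    by (simp add: inner_vec_def matrix_vector_mult_def differential_def grad_def mult.commute)
  interpret chart_ricci_hessian c "dom_of c" ?h \<Gamma> "g c" \<tau> \<alpha> \<sigma> f J
  proof
    show "smooth \<tau>" "open J" "smooth_on J f" "\<tau> ` dom_of c \<subseteq> J"
      using st f sub by auto
    fix q assume q: "q \<in> dom_of c"
    show "\<alpha> q = f (\<tau> q)" using alpha sub q by auto
    show "transpose (g c q) = g c q" by (rule riemannian_metric_sym[OF metric c q])
    show "g c q ** ?h q = mat 1" by (rule matrix_inv_right[OF metric_invertible[OF metric c q]])
    show "\<alpha> q * hess \<tau> j k q + (\<Sum>i\<in>UNIV. curv i j q $ i $ k) = \<sigma> q * g c q $ j $ k" for j k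
      using arg_cong[OF equation[rule_format, OF c q], of "\<lambda>M. M $ j $ k"] by (simp add: hess ric)
    \<comment> \<open>Equality of \<open>Y\<close> with its expression in this chart holds on the
      whole chart domain, which is what permits differentiating it.\<close>
    have "partial c j Y q = partial c j (\<lambda>p. \<Sum>i\<in>UNIV. cov (grad \<tau>) i i p) q" for j
      by (rule partial_cong[OF q Yc])
    moreover have "v c q $ k = grad \<tau> k q" for k
      by (simp add: v gradient_def grad_def matrix_vector_mult_def differential_def)
    ultimately show "2 * (\<Sum>k\<in>UNIV. grad \<tau> k q * (\<Sum>i\<in>UNIV. curv i k q $ i $ j)) =
        - partial c j (\<lambda>p. \<Sum>i\<in>UNIV. cov (grad \<tau>) i i p) q" for j
      using arg_cong[OF ricci_v[rule_format, OF c q], of "\<lambda>x. x $ j"]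
      by (simp add: vector_matrix_mult_def ric differential_def mult.commute)
  qed
  have Q_eq: "Q q = Qc q" and Y_eq: "Y q = Yc q" if "q \<in> dom_of c" for q
    using Qc[OF that] Yc[OF that] by (simp_all add: Qc_def Yc_def)
  have sQ: "smooth Q" and sY: "smooth Y"
    using smooth_cong[OF smooth_Qc] smooth_cong[OF smooth_Yc] Q_eq Y_eq by simp_all
  have dQ: "partial c j Q q = partial c j Qc q" and dY: "partial c j Y q = partial c j Yc q" if "q \<in> dom_of c" for q j
    using partial_cong[OF that Q_eq] partial_cong[OF that Y_eq] by simp_all
  let ?\<kappa> = "\<lambda>q. deriv (deriv f) (\<tau> q) + \<alpha> q * deriv f (\<tau> q)"
  have s\<kappa>: "smooth ?\<kappa>"
    using smooth_compose[OF st _ J(3)] smooth_on_deriv J smooth_\<alpha> by simp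
  obtain i where i: "partial c i \<tau> p \<noteq> 0"
    using nz(2) by (auto simp: differential_def vec_eq_iff)
  have wQ: "?\<kappa> q * (partial c i \<tau> q * partial c j Q q - partial c j \<tau> q * partial c i Q q) = 0"
    if "q \<in> dom_of c" for q j
    using wedge_Q[OF that] dQ[OF that] by simp
  have wY: "?\<kappa> q * (partial c i \<tau> q * partial c j Y q - partial c j \<tau> q * partial c i Y q) = 0"
    if "q \<in> dom_of c" for q j
    \<comment> \<open>By \<open>wedge_Y\<close> the expression for \<open>Y\<close> is \<alpha>
      times the one for \<open>Q\<close>, so either the factor \<open>?\<kappa> q\<close> vanishes
      or both expressions do.\<close>
    using wedge_Q[OF that, of i j] wedge_Y[OF that, of i j] dY[OF that] by auto
  show "locally_function_of M p Q \<tau> \<and> locally_function_of M p Y \<tau>"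
    using locally_function_of_proportional[OF chart p st sQ s\<kappa> nz(1) i wQ]
      locally_function_of_proportional[OF chart p st sY s\<kappa> nz(1) i wY] by blast
qed

end
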